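(* Let $\nu\in\mathbb{R}$ and $t\ge 0$. For every $a>0$, $$\Pr\{A_t^{(\nu)}\le a\}=a^{2\nu}e^{-2/a}\,E\Big[\big(a+A_t^{(\nu)}\big)^{-2\nu}\exp\Big(\frac{2\exp(B_t+\nu t-t/2)}{a+A_t^{(\nu)}}\Big)\Big].$$
   Context: $(B_t)_{t\ge 0}$ is a standard one-dimensional Brownian motion started at $0$. For $\nu\in\mathbb{R}$, $A_t^{(\nu)}=\int_0^t\exp(B_s+\nu s-s/2)\,ds$. *)

theory Defs
  imports "HOL-Probability.Probability"
begin

(* Paths are required to be continuous on {0..} for every \<omega>, not only almost surely,
   so that path functionals are random variables even when M is not complete.
   Values of B at negative times are irrelevant. *)
locale brownian_motion = prob_space M for M :: "'a measure" +
  fixes B :: "real \<Rightarrow> 'a \<Rightarrow> real"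
  assumes measurable_BM: "\<And>t. 0 \<le> t \<Longrightarrow> random_variable borel (B t)"
    and start_zero: "AE \<omega> in M. B 0 \<omega> = 0"
    and indep_increments:
      "\<And>(n::nat) (\<tau> :: nat \<Rightarrow> real).
         0 \<le> \<tau> 0 \<Longrightarrow> (\<And>i. i < n \<Longrightarrow> \<tau> i < \<tau> (Suc i)) \<Longrightarrow>
         indep_vars (\<lambda>_. borel) (\<lambda>i \<omega>. B (\<tau> (Suc i)) \<omega> - B (\<tau> i) \<omega>) {..<n}"
    and normal_increments:
      "\<And>s t. 0 \<le> s \<Longrightarrow> s < t \<Longrightarrow>
         distributed M lborel (\<lambda>\<omega>. B t \<omega> - B s \<omega>) (normal_density 0 (sqrt (t - s)))"
    and continuous_paths:
      "\<And>\<omega>. \<omega> \<in> space M \<Longrightarrow> continuous_on {0..} (\<lambda>t. B t \<omega>)"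

definition geom_BM :: "(real \<Rightarrow> 'a \<Rightarrow> real) \<Rightarrow> real \<Rightarrow> real \<Rightarrow> 'a \<Rightarrow> real" where
  "geom_BM B \<nu> t \<omega> = exp (B t \<omega> + \<nu> * t - t / 2)"

definition exp_functional :: "(real \<Rightarrow> 'a \<Rightarrow> real) \<Rightarrow> real \<Rightarrow> real \<Rightarrow> 'a \<Rightarrow> real" where
  "exp_functional B \<nu> t \<omega> = (LBINT s:{0..t}. geom_BM B \<nu> s \<omega>)"

end

theory Submission
  imports Defs "HOL-Real_Asymp.Real_Asymp"
begin

text \<open>Write \<open>X\<close> for \<open>geom_BM\<close> and \<open>A\<close> for \<open>exp_functional\<close>. For real \<open>c\<close>, the path transformation
  \<open>X \<mapsto> X / (1 - c A)^2\<close>, which turns \<open>1 / A\<close> into \<open>1 / A - c\<close>, shifts the Brownian motion by the adapted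
  drift \<open>2 c X / (1 - c A)\<close>. By Girsanov and Ito, its density is the explicit function
  \<open>(1 - c A)^(-2 \<nu>) exp (2 c - 2 c X / (1 - c A))\<close> of the end point, on the event \<open>c A < 1\<close>.
  No stochastic integral is needed: on a grid, Girsanov's formula is an exact identity for Gaussian
  increments; replacing the increments \<open>\<xi>\<close> in the weight by \<open>exp (\<xi> - h / 2) - 1\<close> costs a martingale that
  vanishes in mean square, after which the weight converges path by path; and Fatou's lemma gives one
  inequality in the limit. Taking \<open>c = - 1 / a\<close> and \<open>c = 1 / a\<close>, which are inverse to each other, gives
  the two inequalities between the right-hand side and \<open>P (A < a)\<close>. Right continuity in \<open>a\<close> then
  replaces \<open>A < a\<close> by \<open>A \<le> a\<close>.\<close>

section \<open>Discrete Girsanov formula\<close>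

text \<open>The sum of \<open>\<theta> * \<xi>\<close> in the Girsanov weight approximates a
  stochastic integral, so continuity of the path alone does not give its limit. But
  \<open>exp (\<xi> - h / 2)\<close> is, up to the factor \<open>exp (- \<nu> * h)\<close>, the
  quotient of two neighbouring values of \<open>X\<close>, and the drift is \<open>X\<close> times
  \<open>2 * c / (1 - c * A)\<close>; after the replacement the sum telescopes up to Riemann sums,
  which is why the density depends on the path only through \<open>X\<close> and \<open>A\<close> at
  the end point. The drift is unbounded, and for \<open>c > 0\<close> its denominator vanishes as
  \<open>c * A\<close> reaches 1; it is therefore truncated at a level that grows with the grid,
  slowly enough for the martingale to vanish. Uniform integrability of the weights is not proved, so
  the limit yields only \<open>\<le>\<close>. The reverse estimate comes from the inverse map:
  \<open>A / (1 - c * A)\<close> sends nonnegative \<open>A\<close> onto the range from 0 to below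
  \<open>a\<close> for \<open>c = - 1 / a\<close>, and back for \<open>c = 1 / a\<close>, and the
  two densities multiply to 1 along the composition.\<close>

lemma (in prob_space) indep_recursion:
  fixes \<xi> :: "nat \<Rightarrow> 'a \<Rightarrow> real" and V :: "nat \<Rightarrow> 'a \<Rightarrow> 's"
  assumes indep: "indep_vars (\<lambda>_. borel) \<xi> {..<n}"
    and step[measurable]: "case_prod step \<in> S \<Otimes>\<^sub>M borel \<rightarrow>\<^sub>M S"
    and V0: "\<And>\<omega>. V 0 \<omega> = v0" "v0 \<in> space S"
    and VSuc: "\<And>k \<omega>. V (Suc k) \<omega> = step (V k \<omega>) (\<xi> k \<omega>)"
    and k: "k < n"
  shows "V k \<in> M \<rightarrow>\<^sub>M S" (is ?m)
    and "distr M (S \<Otimes>\<^sub>M borel) (\<lambda>\<omega>. (V k \<omega>, \<xi> k \<omega>)) = distr M S (V k) \<Otimes>\<^sub>M distr M borel (\<xi> k)" (is ?d)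
proof -
  \<comment> \<open>The state before step \<open>k\<close> depends only on the increments with index
    below \<open>k\<close>, so independence of \<open>V k\<close> and \<open>\<xi> k\<close> is
    inherited from the disjoint index sets \<open>{..<k}\<close> and \<open>{k}\<close>.\<close>
  have "\<exists>f. f \<in> PiM {..<k} (\<lambda>_. borel) \<rightarrow>\<^sub>M S \<and> (\<forall>\<omega>. V k \<omega> = f (restrict (\<lambda>i. \<xi> i \<omega>) {..<k}))"
  proof (induction k)
    case 0
    show ?case using V0 by (intro exI[of _ "\<lambda>_. v0"]) auto
  next
    case (Suc k)
    then obtain f where f[measurable]: "f \<in> PiM {..<k} (\<lambda>_. borel) \<rightarrow>\<^sub>M S"
      and eq: "\<And>\<omega>. V k \<omega> = f (restrict (\<lambda>i. \<xi> i \<omega>) {..<k})" by blast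
    define g where "g x = step (f (restrict x {..<k})) (x k)" for x :: "nat \<Rightarrow> real"
    have [measurable]: "(\<lambda>x. restrict x {..<k}) \<in> PiM {..<Suc k} (\<lambda>_. borel) \<rightarrow>\<^sub>M PiM {..<k} (\<lambda>_. borel :: real measure)"
      by (rule measurable_restrict_subset) auto
    have [measurable]: "(\<lambda>x. x k) \<in> PiM {..<Suc k} (\<lambda>_. borel) \<rightarrow>\<^sub>M (borel :: real measure)"
      by (rule measurable_component_singleton) auto
    have "g \<in> PiM {..<Suc k} (\<lambda>_. borel) \<rightarrow>\<^sub>M S"
      unfolding g_def by measurable
    moreover have "V (Suc k) \<omega> = g (restrict (\<lambda>i. \<xi> i \<omega>) {..<Suc k})" for \<omega>
    proof -
      have "restrict (restrict (\<lambda>i. \<xi> i \<omega>) {..<Suc k}) {..<k} = restrict (\<lambda>i. \<xi> i \<omega>) {..<k}"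
        by (auto simp: restrict_def fun_eq_iff)
      then show ?thesis by (simp add: g_def VSuc eq)
    qed
    ultimately show ?case by blast
  qed
  then obtain f where f[measurable]: "f \<in> PiM {..<k} (\<lambda>_. borel) \<rightarrow>\<^sub>M S"
    and eq: "\<And>\<omega>. V k \<omega> = f (restrict (\<lambda>i. \<xi> i \<omega>) {..<k})" by blast
  let ?A = "PiM {..<k} (\<lambda>_. borel :: real measure)" and ?B = "PiM {k} (\<lambda>_. borel :: real measure)"
  let ?a = "\<lambda>\<omega>. restrict (\<lambda>i. \<xi> i \<omega>) {..<k}" and ?b = "\<lambda>\<omega>. restrict (\<lambda>i. \<xi> i \<omega>) {k}"
  have ind: "indep_var ?A ?a ?B ?b"
    using k by (intro indep_var_restrict[OF indep]) auto
  note [measurable] = indep_var_rv1[OF ind] indep_var_rv2[OF ind]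
  have [measurable]: "(\<lambda>x. x k) \<in> ?B \<rightarrow>\<^sub>M borel"
    by (rule measurable_component_singleton) auto
  have V_eq: "V k = (\<lambda>\<omega>. f (?a \<omega>))" and \<xi>_eq: "\<xi> k = (\<lambda>\<omega>. ?b \<omega> k)"
    by (auto simp: eq)
  show ?m unfolding V_eq by measurable
  have [measurable]: "\<xi> k \<in> M \<rightarrow>\<^sub>M borel" by (subst \<xi>_eq) measurable
  have dV: "distr M S (V k) = distr (distr M ?A ?a) S f"
    by (subst distr_distr) (auto simp: V_eq o_def)
  have d\<xi>: "distr M borel (\<xi> k) = distr (distr M ?B ?b) borel (\<lambda>x. x k)"
    by (subst distr_distr) (auto simp: o_def)
  have sf: "sigma_finite_measure (distr (distr M ?B ?b) borel (\<lambda>x. x k))"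
    unfolding d\<xi>[symmetric] by (intro prob_space_imp_sigma_finite prob_space_distr) measurable
  have "distr M S (V k) \<Otimes>\<^sub>M distr M borel (\<xi> k)
      = distr (distr M ?A ?a \<Otimes>\<^sub>M distr M ?B ?b) (S \<Otimes>\<^sub>M borel) (\<lambda>(x, y). (f x, y k))"
    unfolding dV d\<xi> by (rule pair_measure_distr) (auto intro: sf)
  also have "\<dots> = distr (distr M (?A \<Otimes>\<^sub>M ?B) (\<lambda>\<omega>. (?a \<omega>, ?b \<omega>))) (S \<Otimes>\<^sub>M borel) (\<lambda>(x, y). (f x, y k))"
    using indep_var_distribution_eq[THEN iffD1, OF ind] by simp
  also have "\<dots> = distr M (S \<Otimes>\<^sub>M borel) (\<lambda>\<omega>. (V k \<omega>, \<xi> k \<omega>))"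
    by (subst distr_distr) (auto simp: o_def V_eq)
  finally show ?d ..
qed

text \<open>Fubini for the product law: the state is frozen while the fresh Gaussian increment is
  integrated out. This takes the place of conditional expectations given the past.\<close>

lemma (in prob_space) nn_integral_indep_normal:
  assumes V[measurable]: "V \<in> M \<rightarrow>\<^sub>M S"
    and indep: "distr M (S \<Otimes>\<^sub>M borel) (\<lambda>\<omega>. (V \<omega>, X \<omega>)) = distr M S V \<Otimes>\<^sub>M distr M borel X"
    and X: "distributed M lborel X (normal_density 0 \<sigma>)"
    and f: "case_prod f \<in> borel_measurable (S \<Otimes>\<^sub>M borel)"
  shows "(\<integral>\<^sup>+\<omega>. f (V \<omega>) (X \<omega>) \<partial>M)
    = (\<integral>\<^sup>+\<omega>. \<integral>\<^sup>+x. ennreal (normal_density 0 \<sigma> x) * f (V \<omega>) x \<partial>lborel \<partial>M)"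
proof -
  define D where "D = density lborel (\<lambda>x. ennreal (normal_density 0 \<sigma> x))"
  note f[measurable]
  have Xm[measurable]: "X \<in> M \<rightarrow>\<^sub>M borel"
    using distributed_measurable[OF X] by simp
  have setsD[measurable_cong]: "sets D = sets borel" by (simp add: D_def)
  have D: "distr M borel X = D"
    using distributed_distr_eq_density[OF X] by (simp add: D_def cong: distr_cong)
  interpret D: prob_space D unfolding D[symmetric] by (rule prob_space_distr) simp
  have "(\<integral>\<^sup>+\<omega>. f (V \<omega>) (X \<omega>) \<partial>M) = (\<integral>\<^sup>+z. case_prod f z \<partial>distr M (S \<Otimes>\<^sub>M borel) (\<lambda>\<omega>. (V \<omega>, X \<omega>)))"
    by (subst nn_integral_distr) auto
  also have "\<dots> = (\<integral>\<^sup>+z. case_prod f z \<partial>(distr M S V \<Otimes>\<^sub>M D))"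
    using indep D by simp
  also have "\<dots> = (\<integral>\<^sup>+v. \<integral>\<^sup>+x. f v x \<partial>D \<partial>distr M S V)"
    by (subst D.nn_integral_fst[symmetric]) auto
  also have "\<dots> = (\<integral>\<^sup>+\<omega>. \<integral>\<^sup>+x. f (V \<omega>) x \<partial>D \<partial>M)"
    by (subst nn_integral_distr) auto
  also have "\<dots> = (\<integral>\<^sup>+\<omega>. \<integral>\<^sup>+x. ennreal (normal_density 0 \<sigma> x) * f (V \<omega>) x \<partial>lborel \<partial>M)"
    unfolding D_def by (intro nn_integral_cong nn_integral_density) (auto simp: D_def)
  finally show ?thesis .
qed

lemma normal_density_shift_weight:
  assumes "0 < h"
  shows "normal_density 0 (sqrt h) x * exp (- \<theta> * x - h * \<theta>\<^sup>2 / 2) = normal_density 0 (sqrt h) (x + h * \<theta>)"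
proof -
  have "- (x\<^sup>2 / (2 * h)) + (- \<theta> * x - h * \<theta>\<^sup>2 / 2) = - ((x + h * \<theta>)\<^sup>2 / (2 * h))"
    using assms by (simp add: field_simps power2_eq_square)
  then have "exp (- (x\<^sup>2 / (2 * h))) * exp (- \<theta> * x - h * \<theta>\<^sup>2 / 2) = exp (- ((x + h * \<theta>)\<^sup>2 / (2 * h)))"
    by (simp only: exp_add[symmetric])
  then show ?thesis using assms by (simp add: normal_density_def)
qed

text \<open>Girsanov's formula for a single increment: \<open>normal_density_shift_weight\<close>
  completes the square, and Lebesgue measure is invariant under translation by
  \<open>h * \<theta>\<close>.\<close>

lemma nn_integral_normal_shift:
  assumes "0 < h" and [measurable]: "f \<in> borel_measurable borel"
  shows "(\<integral>\<^sup>+x. ennreal (normal_density 0 (sqrt h) x) *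
      (f (x + h * \<theta>) * ennreal (exp (- \<theta> * x - h * \<theta>\<^sup>2 / 2))) \<partial>lborel)
    = (\<integral>\<^sup>+x. ennreal (normal_density 0 (sqrt h) x) * f x \<partial>lborel)"
proof -
  have "(\<integral>\<^sup>+x. ennreal (normal_density 0 (sqrt h) x) * f x \<partial>lborel)
     = (\<integral>\<^sup>+x. ennreal (normal_density 0 (sqrt h) (x + h * \<theta>)) * f (x + h * \<theta>) \<partial>lborel)"
    using nn_integral_real_affine[of "\<lambda>x. ennreal (normal_density 0 (sqrt h) x) * f x" 1 "h * \<theta>"]
    by (simp add: add.commute)
  also have "\<dots> = (\<integral>\<^sup>+x. ennreal (normal_density 0 (sqrt h) x) *
      (f (x + h * \<theta>) * ennreal (exp (- \<theta> * x - h * \<theta>\<^sup>2 / 2))) \<partial>lborel)"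
  proof (intro nn_integral_cong)
    fix x
    have "ennreal (normal_density 0 (sqrt h) (x + h * \<theta>))
      = ennreal (normal_density 0 (sqrt h) x) * ennreal (exp (- \<theta> * x - h * \<theta>\<^sup>2 / 2))"
      by (subst normal_density_shift_weight[OF \<open>0 < h\<close>, symmetric]) (simp add: ennreal_mult')
    then show "ennreal (normal_density 0 (sqrt h) (x + h * \<theta>)) * f (x + h * \<theta>)
      = ennreal (normal_density 0 (sqrt h) x) * (f (x + h * \<theta>) * ennreal (exp (- \<theta> * x - h * \<theta>\<^sup>2 / 2)))"
      by (simp only: mult_ac)
  qed
  finally show ?thesis ..
qed

text \<open>The drift is read off the unshifted chain \<open>p\<close> before \<open>\<xi> k\<close>
  is drawn, so each shift is a constant once the past is frozen. Under the weight the shifted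
  increments are again independent centred Gaussians, and \<open>q\<close> runs on them the
  recursion that \<open>p\<close> runs on the original ones; hence \<open>q\<close> acquires the law
  of \<open>p\<close>.\<close>

lemma (in prob_space) discrete_girsanov:
  fixes \<xi> :: "nat \<Rightarrow> 'a \<Rightarrow> real" and p q :: "nat \<Rightarrow> 'a \<Rightarrow> 's" and w :: "nat \<Rightarrow> 'a \<Rightarrow> real"
  assumes h: "0 < h"
    and indep: "indep_vars (\<lambda>_. borel) \<xi> {..<n}"
    and normal: "\<And>k. k < n \<Longrightarrow> distributed M lborel (\<xi> k) (normal_density 0 (sqrt h))"
    and step[measurable]: "case_prod step \<in> S \<Otimes>\<^sub>M borel \<rightarrow>\<^sub>M S"
    and \<theta>[measurable]: "\<theta> \<in> borel_measurable S"
    and init: "\<And>\<omega>. p 0 \<omega> = p0" "\<And>\<omega>. q 0 \<omega> = p0" "\<And>\<omega>. w 0 \<omega> = 0" "p0 \<in> space S"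
    and p_Suc: "\<And>k \<omega>. p (Suc k) \<omega> = step (p k \<omega>) (\<xi> k \<omega>)"
    and q_Suc: "\<And>k \<omega>. q (Suc k) \<omega> = step (q k \<omega>) (\<xi> k \<omega> + h * \<theta> (p k \<omega>))"
    and w_Suc: "\<And>k \<omega>. w (Suc k) \<omega> = w k \<omega> + (- \<theta> (p k \<omega>) * \<xi> k \<omega> - h * (\<theta> (p k \<omega>))\<^sup>2 / 2)"
    and H: "H \<in> borel_measurable S" and k: "k \<le> n"
  shows "(\<integral>\<^sup>+\<omega>. H (q k \<omega>) * ennreal (exp (w k \<omega>)) \<partial>M) = (\<integral>\<^sup>+\<omega>. H (p k \<omega>) \<partial>M)"
  using k H
proof (induction k arbitrary: H)
  case 0
  then show ?case by (simp add: init)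
next
  case (Suc k)
  note [measurable] = Suc.prems(2)
  let ?N = "\<lambda>x. ennreal (normal_density 0 (sqrt h) x)"
  have kn: "k < n" using Suc by simp
  \<comment> \<open>\<open>q\<close> and \<open>w\<close> are not recursions by themselves, as their
    steps involve \<open>p\<close>; the triple is one.\<close>
  define V where "V k \<omega> = (p k \<omega>, q k \<omega>, w k \<omega>)" for k \<omega>
  define st where "st = (\<lambda>v x. (step (fst v) x, step (fst (snd v)) (x + h * \<theta> (fst v)),
      snd (snd v) + (- \<theta> (fst v) * x - h * (\<theta> (fst v))\<^sup>2 / 2) :: real))"
  have [measurable]: "case_prod st \<in> (S \<Otimes>\<^sub>M S \<Otimes>\<^sub>M borel) \<Otimes>\<^sub>M borel \<rightarrow>\<^sub>M (S \<Otimes>\<^sub>M S \<Otimes>\<^sub>M borel)"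
    unfolding st_def by measurable
  note ind = indep_recursion[OF indep, where V = V and S = "S \<Otimes>\<^sub>M S \<Otimes>\<^sub>M borel"
      and step = st and ?v0.0 = "(p0, p0, 0)" and k = k]
  have Vm[measurable]: "V k \<in> M \<rightarrow>\<^sub>M (S \<Otimes>\<^sub>M S \<Otimes>\<^sub>M borel)"
    by (rule ind(1)) (use kn in \<open>auto simp: V_def st_def init p_Suc q_Suc w_Suc space_pair_measure\<close>)
  have Vd: "distr M ((S \<Otimes>\<^sub>M S \<Otimes>\<^sub>M borel) \<Otimes>\<^sub>M borel) (\<lambda>\<omega>. (V k \<omega>, \<xi> k \<omega>))
      = distr M (S \<Otimes>\<^sub>M S \<Otimes>\<^sub>M borel) (V k) \<Otimes>\<^sub>M distr M borel (\<xi> k)"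
    by (rule ind(2)) (use kn in \<open>auto simp: V_def st_def init p_Suc q_Suc w_Suc space_pair_measure\<close>)
  have pm: "p k \<in> M \<rightarrow>\<^sub>M S"
    and pd: "distr M (S \<Otimes>\<^sub>M borel) (\<lambda>\<omega>. (p k \<omega>, \<xi> k \<omega>)) = distr M S (p k) \<Otimes>\<^sub>M distr M borel (\<xi> k)"
    using indep_recursion[OF indep step init(1,4) p_Suc kn] by auto
  \<comment> \<open>One step of the transition kernel of \<open>p\<close>, applied to
    \<open>H\<close>. The last weight factor undoes the last shift, so integrating out the last
    increment leaves \<open>H'\<close> at \<open>q k\<close> with weight \<open>w k\<close>. The
    induction hypothesis is then used for \<open>H'\<close>, which is why \<open>H\<close> has to be
    arbitrary.\<close>
  define H' where "H' a = (\<integral>\<^sup>+x. ?N x * H (step a x) \<partial>lborel)" for a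
  have [measurable]: "H' \<in> borel_measurable S"
    unfolding H'_def by measurable
  let ?f = "\<lambda>v x. H (step (fst (snd v)) (x + h * \<theta> (fst v)))
      * ennreal (exp (snd (snd v) + (- \<theta> (fst v) * x - h * (\<theta> (fst v))\<^sup>2 / 2)))"
  have fm[measurable]: "case_prod ?f \<in> borel_measurable ((S \<Otimes>\<^sub>M S \<Otimes>\<^sub>M borel) \<Otimes>\<^sub>M borel)"
    by measurable
  have inner: "(\<integral>\<^sup>+x. ?N x * ?f v x \<partial>lborel) = H' (fst (snd v)) * ennreal (exp (snd (snd v)))"
    if "v \<in> space (S \<Otimes>\<^sub>M S \<Otimes>\<^sub>M borel)" for v
  proof -
    obtain a b c where v: "v = (a, b, c)" by (cases v) auto
    with that have a: "a \<in> space S" and b: "b \<in> space S" by (auto simp: space_pair_measure)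
    have [measurable]: "step b \<in> borel \<rightarrow>\<^sub>M S" using measurable_Pair2[OF step b] by simp
    have "(\<integral>\<^sup>+x. ?N x * ?f v x \<partial>lborel)
      = (\<integral>\<^sup>+x. (?N x * (H (step b (x + h * \<theta> a)) * ennreal (exp (- \<theta> a * x - h * (\<theta> a)\<^sup>2 / 2)))) * ennreal (exp c) \<partial>lborel)"
      unfolding v by (intro nn_integral_cong) (simp add: exp_add ennreal_mult' mult_ac)
    also have "\<dots> = (\<integral>\<^sup>+x. ?N x * (H (step b (x + h * \<theta> a)) * ennreal (exp (- \<theta> a * x - h * (\<theta> a)\<^sup>2 / 2))) \<partial>lborel) * ennreal (exp c)"
      by (rule nn_integral_multc) measurable
    also have "\<dots> = H' b * ennreal (exp c)"
      unfolding H'_def by (subst nn_integral_normal_shift[OF h]) auto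
    finally show ?thesis by (simp add: v)
  qed
  have "(\<integral>\<^sup>+\<omega>. H (q (Suc k) \<omega>) * ennreal (exp (w (Suc k) \<omega>)) \<partial>M) = (\<integral>\<^sup>+\<omega>. ?f (V k \<omega>) (\<xi> k \<omega>) \<partial>M)"
    by (simp add: V_def q_Suc w_Suc)
  also have "\<dots> = (\<integral>\<^sup>+\<omega>. \<integral>\<^sup>+x. ?N x * ?f (V k \<omega>) x \<partial>lborel \<partial>M)"
    by (rule nn_integral_indep_normal[OF Vm Vd normal[OF kn] fm])
  also have "\<dots> = (\<integral>\<^sup>+\<omega>. H' (fst (snd (V k \<omega>))) * ennreal (exp (snd (snd (V k \<omega>)))) \<partial>M)"
    by (intro nn_integral_cong inner) (rule measurable_space[of "V k" M], auto)
  also have "\<dots> = (\<integral>\<^sup>+\<omega>. H' (q k \<omega>) * ennreal (exp (w k \<omega>)) \<partial>M)"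
    by (simp add: V_def)
  also have "\<dots> = (\<integral>\<^sup>+\<omega>. H' (p k \<omega>) \<partial>M)"
    by (rule Suc.IH) (use kn in auto)
  also have "\<dots> = (\<integral>\<^sup>+\<omega>. H (p (Suc k) \<omega>) \<partial>M)"
    unfolding H'_def p_Suc
    by (rule nn_integral_indep_normal[OF pm pd normal[OF kn], symmetric]) measurable
  finally show ?case .
qed

section \<open>Second moment of the martingale that replaces the Gaussian increments\<close>

lemma nn_integral_normal_square:
  assumes h: "0 < h"
  shows "(\<integral>\<^sup>+x. ennreal (normal_density 0 (sqrt h) x) * ennreal ((s + \<theta> * (exp (x - h / 2) - 1 - x))\<^sup>2) \<partial>lborel)
    = ennreal (s\<^sup>2 + \<theta>\<^sup>2 * (exp h - 1 - h))"
proof -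
  let ?N = "normal_density 0 (sqrt h)"
  have sh: "?N x * exp (c * x - h * c\<^sup>2 / 2) = normal_density (h * c) (sqrt h) x" for c x
    using normal_density_shift_weight[OF h, of x "- c"] by (simp add: normal_density_def)
  have u: "?N x * exp (x - h / 2) = normal_density h (sqrt h) x" for x
    using sh[of x 1] by simp
  have uu: "?N x * (exp (x - h / 2))\<^sup>2 = exp h * normal_density (2 * h) (sqrt h) x" for x
  proof -
    have "?N x * (exp (x - h / 2))\<^sup>2 = exp h * (?N x * exp (2 * x - h * 2\<^sup>2 / 2))"
      by (simp add: exp_add[symmetric] power2_eq_square mult.left_commute)
    then show ?thesis unfolding sh by (simp add: mult.commute)
  qed
  have one: "has_bochner_integral lborel (normal_density \<mu> (sqrt h)) 1" for \<mu>
    using normal_moment_even[of "sqrt h" \<mu> 0] h by simp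
  have var: "has_bochner_integral lborel (\<lambda>x. ?N x * x\<^sup>2) h"
    using normal_moment_even[of "sqrt h" 0 1] h by simp
  have m1: "has_bochner_integral lborel (\<lambda>x. normal_density \<mu> (sqrt h) x * x) \<mu>" for \<mu>
    using normal_moment_nz_1[of "sqrt h" \<mu>] h by simp
  \<comment> \<open>The expanded square, with each exponential absorbed into a normal density of
    shifted mean, so that only Gaussian moments up to order two occur. The bracket after
    \<open>2 * s * \<theta>\<close> integrates to 0, the one after \<open>\<theta>\<^sup>2\<close>
    to \<open>exp h - 1 - h\<close>.\<close>
  let ?g = "\<lambda>x. s\<^sup>2 * ?N x + 2 * s * \<theta> * (normal_density h (sqrt h) x - ?N x - ?N x * x)
      + \<theta>\<^sup>2 * (exp h * normal_density (2 * h) (sqrt h) x + ?N x + ?N x * x\<^sup>2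
        - 2 * normal_density h (sqrt h) x - 2 * (normal_density h (sqrt h) x * x) + 2 * (?N x * x))"
  have "has_bochner_integral lborel ?g (s\<^sup>2 * 1 + 2 * s * \<theta> * (1 - 1 - 0)
      + \<theta>\<^sup>2 * (exp h * 1 + 1 + h - 2 * 1 - 2 * h + 2 * 0))"
    by (intro has_bochner_integral_add has_bochner_integral_diff has_bochner_integral_mult_right one var m1)
  moreover have "?g = (\<lambda>x. ?N x * (s + \<theta> * (exp (x - h / 2) - 1 - x))\<^sup>2)"
    unfolding u[symmetric] uu[symmetric] by (rule ext) (simp add: algebra_simps power2_eq_square)
  ultimately have hb: "has_bochner_integral lborel (\<lambda>x. ?N x * (s + \<theta> * (exp (x - h / 2) - 1 - x))\<^sup>2)
      (s\<^sup>2 + \<theta>\<^sup>2 * (exp h - 1 - h))"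
    by simp
  have "(\<integral>\<^sup>+x. ennreal (?N x) * ennreal ((s + \<theta> * (exp (x - h / 2) - 1 - x))\<^sup>2) \<partial>lborel)
      = (\<integral>\<^sup>+x. ennreal (?N x * (s + \<theta> * (exp (x - h / 2) - 1 - x))\<^sup>2) \<partial>lborel)"
    by (simp add: ennreal_mult)
  also have "\<dots> = ennreal (s\<^sup>2 + \<theta>\<^sup>2 * (exp h - 1 - h))"
    using hb by (subst nn_integral_eq_integral) (auto simp: has_bochner_integral_iff)
  finally show ?thesis .
qed

text \<open>Each summand has mean zero given the past, so cross terms vanish and second moments add
  up. A step costs at most \<open>C\<^sup>2 * (exp h - 1 - h)\<close>, which is of second order in
  \<open>h\<close>, while the number of steps is only of order \<open>1 / h\<close>.\<close>

lemma (in prob_space) martingale_square_bound: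
  fixes \<xi> :: "nat \<Rightarrow> 'a \<Rightarrow> real" and p :: "nat \<Rightarrow> 'a \<Rightarrow> 's" and s :: "nat \<Rightarrow> 'a \<Rightarrow> real"
  assumes h: "0 < h"
    and indep: "indep_vars (\<lambda>_. borel) \<xi> {..<n}"
    and normal: "\<And>k. k < n \<Longrightarrow> distributed M lborel (\<xi> k) (normal_density 0 (sqrt h))"
    and step[measurable]: "case_prod step \<in> S \<Otimes>\<^sub>M borel \<rightarrow>\<^sub>M S"
    and \<theta>[measurable]: "\<theta> \<in> borel_measurable S" and \<theta>_bound: "\<And>x. \<bar>\<theta> x\<bar> \<le> C"
    and init: "\<And>\<omega>. p 0 \<omega> = p0" "\<And>\<omega>. s 0 \<omega> = 0" "p0 \<in> space S"
    and p_Suc: "\<And>k \<omega>. p (Suc k) \<omega> = step (p k \<omega>) (\<xi> k \<omega>)"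
    and s_Suc: "\<And>k \<omega>. s (Suc k) \<omega> = s k \<omega> + \<theta> (p k \<omega>) * (exp (\<xi> k \<omega> - h / 2) - 1 - \<xi> k \<omega>)"
    and k: "k \<le> n"
  shows "s k \<in> borel_measurable M \<and> (\<integral>\<^sup>+\<omega>. ennreal ((s k \<omega>)\<^sup>2) \<partial>M) \<le> ennreal (real k * (C\<^sup>2 * (exp h - 1 - h)))"
  using k
proof (induction k)
  case 0
  have "s 0 = (\<lambda>_. 0)" using init by auto
  then show ?case by simp
next
  case (Suc k)
  let ?N = "\<lambda>x. ennreal (normal_density 0 (sqrt h) x)"
  have kn: "k < n" using Suc by simp
  have v: "0 \<le> exp h - 1 - h" using exp_ge_add_one_self[of h] by linarith
  have C: "(\<theta> x)\<^sup>2 \<le> C\<^sup>2" for x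
    using \<theta>_bound[of x] by (rule abs_le_square_iff[THEN iffD1, OF order.trans]) simp
  define V where "V k \<omega> = (p k \<omega>, s k \<omega>)" for k \<omega>
  define st where "st = (\<lambda>v x. (step (fst v) x, snd v + \<theta> (fst v) * (exp (x - h / 2) - 1 - x)))"
  have [measurable]: "case_prod st \<in> (S \<Otimes>\<^sub>M borel) \<Otimes>\<^sub>M borel \<rightarrow>\<^sub>M (S \<Otimes>\<^sub>M borel)"
    unfolding st_def by measurable
  note ind = indep_recursion[OF indep, where V = V and S = "S \<Otimes>\<^sub>M borel"
      and step = st and ?v0.0 = "(p0, 0)" and k = k]
  have Vm[measurable]: "V k \<in> M \<rightarrow>\<^sub>M (S \<Otimes>\<^sub>M borel)"
    by (rule ind(1)) (use kn in \<open>auto simp: V_def st_def init p_Suc s_Suc space_pair_measure\<close>)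
  have Vd: "distr M ((S \<Otimes>\<^sub>M borel) \<Otimes>\<^sub>M borel) (\<lambda>\<omega>. (V k \<omega>, \<xi> k \<omega>))
      = distr M (S \<Otimes>\<^sub>M borel) (V k) \<Otimes>\<^sub>M distr M borel (\<xi> k)"
    by (rule ind(2)) (use kn in \<open>auto simp: V_def st_def init p_Suc s_Suc space_pair_measure\<close>)
  have [measurable]: "\<xi> k \<in> borel_measurable M"
    using distributed_measurable[OF normal[OF kn]] by simp
  let ?f = "\<lambda>v x. ennreal ((snd v + \<theta> (fst v) * (exp (x - h / 2) - 1 - x))\<^sup>2)"
  have fm: "case_prod ?f \<in> borel_measurable ((S \<Otimes>\<^sub>M borel) \<Otimes>\<^sub>M borel)"
    by measurable
  have "s (Suc k) = (\<lambda>\<omega>. snd (V k \<omega>) + \<theta> (fst (V k \<omega>)) * (exp (\<xi> k \<omega> - h / 2) - 1 - \<xi> k \<omega>))"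
    by (auto simp: V_def s_Suc)
  then have meas: "s (Suc k) \<in> borel_measurable M" by simp
  have [measurable]: "s k \<in> borel_measurable M" using Suc by simp
  have "(\<integral>\<^sup>+\<omega>. ennreal ((s (Suc k) \<omega>)\<^sup>2) \<partial>M) = (\<integral>\<^sup>+\<omega>. ?f (V k \<omega>) (\<xi> k \<omega>) \<partial>M)"
    by (simp add: V_def s_Suc)
  also have "\<dots> = (\<integral>\<^sup>+\<omega>. \<integral>\<^sup>+x. ?N x * ?f (V k \<omega>) x \<partial>lborel \<partial>M)"
    by (rule nn_integral_indep_normal[OF Vm Vd normal[OF kn] fm])
  also have "\<dots> = (\<integral>\<^sup>+\<omega>. ennreal ((s k \<omega>)\<^sup>2 + (\<theta> (p k \<omega>))\<^sup>2 * (exp h - 1 - h)) \<partial>M)"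
    by (simp add: nn_integral_normal_square[OF h] V_def)
  also have "\<dots> \<le> (\<integral>\<^sup>+\<omega>. ennreal ((s k \<omega>)\<^sup>2) + ennreal (C\<^sup>2 * (exp h - 1 - h)) \<partial>M)"
  proof (intro nn_integral_mono)
    fix \<omega>
    have "ennreal ((s k \<omega>)\<^sup>2 + (\<theta> (p k \<omega>))\<^sup>2 * (exp h - 1 - h)) \<le> ennreal ((s k \<omega>)\<^sup>2 + C\<^sup>2 * (exp h - 1 - h))"
      by (intro ennreal_leI add_left_mono mult_right_mono C v)
    then show "ennreal ((s k \<omega>)\<^sup>2 + (\<theta> (p k \<omega>))\<^sup>2 * (exp h - 1 - h))
        \<le> ennreal ((s k \<omega>)\<^sup>2) + ennreal (C\<^sup>2 * (exp h - 1 - h))"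
      using v by (subst ennreal_plus[symmetric]) auto
  qed
  also have "\<dots> = (\<integral>\<^sup>+\<omega>. ennreal ((s k \<omega>)\<^sup>2) \<partial>M) + ennreal (C\<^sup>2 * (exp h - 1 - h))"
    by (subst nn_integral_add) (auto simp: emeasure_space_1)
  also have "\<dots> \<le> ennreal (real k * (C\<^sup>2 * (exp h - 1 - h))) + ennreal (C\<^sup>2 * (exp h - 1 - h))"
    using Suc by (intro add_right_mono) auto
  also have "\<dots> = ennreal (real (Suc k) * (C\<^sup>2 * (exp h - 1 - h)))"
    using v by (subst ennreal_plus[symmetric]) (auto simp: distrib_right)
  finally show ?case using meas by simp
qed

text \<open>The series of squares has finite integral, so it converges almost everywhere and its
  terms vanish. This yields convergence along the whole sequence of grids, without passing to a
  subsequence.\<close>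

lemma AE_tendsto_0_of_summable_squares:
  fixes f :: "nat \<Rightarrow> 'a \<Rightarrow> real"
  assumes [measurable]: "\<And>n. f n \<in> borel_measurable M"
    and bound: "\<And>n. (\<integral>\<^sup>+x. ennreal ((f n x)\<^sup>2) \<partial>M) \<le> ennreal (c n)"
    and c: "\<And>n. 0 \<le> c n" "summable c"
  shows "AE x in M. (\<lambda>n. f n x) \<longlonglongrightarrow> 0"
proof -
  have "(\<integral>\<^sup>+x. (\<Sum>n. ennreal ((f n x)\<^sup>2)) \<partial>M) = (\<Sum>n. \<integral>\<^sup>+x. ennreal ((f n x)\<^sup>2) \<partial>M)"
    by (rule nn_integral_suminf) measurable
  also have "\<dots> \<le> (\<Sum>n. ennreal (c n))"
    by (intro suminf_le bound) auto
  also have "\<dots> = ennreal (\<Sum>n. c n)"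
    using c by (intro suminf_ennreal2) auto
  finally have "(\<integral>\<^sup>+x. (\<Sum>n. ennreal ((f n x)\<^sup>2)) \<partial>M) \<noteq> \<infinity>"
    by (auto simp: top_unique)
  then have "AE x in M. (\<Sum>n. ennreal ((f n x)\<^sup>2)) \<noteq> \<infinity>"
    by (intro nn_integral_noteq_infinite) auto
  then show ?thesis
  proof eventually_elim
    case (elim x)
    then have "summable (\<lambda>n. (f n x)\<^sup>2)"
      by (intro summable_suminf_not_top) auto
    then have "(\<lambda>n. (f n x)\<^sup>2) \<longlonglongrightarrow> 0" by (rule summable_LIMSEQ_zero)
    then show ?case by simp
  qed
qed

section \<open>Riemann sums along a path\<close>

lemma floor_grid_tendsto:
  fixes h :: "nat \<Rightarrow> real"
  assumes "\<And>n. 0 < h n" "h \<longlonglongrightarrow> 0" "0 \<le> u"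
  shows "(\<lambda>n. real (nat \<lfloor>u / h n\<rfloor>) * h n) \<longlonglongrightarrow> u"
proof (rule tendsto_sandwich)
  have *: "u - h n \<le> real (nat \<lfloor>u / h n\<rfloor>) * h n \<and> real (nat \<lfloor>u / h n\<rfloor>) * h n \<le> u" for n
  proof -
    have 1: "real (nat \<lfloor>u / h n\<rfloor>) \<le> u / h n" "u / h n \<le> real (nat \<lfloor>u / h n\<rfloor>) + 1"
      using assms(1)[of n] assms(3) by (auto, linarith?)
    show ?thesis
      using 1 assms(1)[of n] by (simp add: field_simps)
  qed
  show "\<forall>\<^sub>F n in sequentially. u - h n \<le> real (nat \<lfloor>u / h n\<rfloor>) * h n"
    "\<forall>\<^sub>F n in sequentially. real (nat \<lfloor>u / h n\<rfloor>) * h n \<le> u"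
    using * by auto
  show "(\<lambda>n. u - h n) \<longlonglongrightarrow> u" using tendsto_diff[OF tendsto_const assms(2), of u] by simp
qed simp

text \<open>Dominated convergence for step functions on the grid cells. The entries
  \<open>f n j\<close> need not be samples of one function: \<open>lim\<close> asks for convergence
  along every sequence of nodes tending to \<open>u\<close>, which also admits entries built from
  neighbouring nodes or from inner Riemann sums.\<close>

lemma grid_sum_tendsto_integral:
  fixes f :: "nat \<Rightarrow> nat \<Rightarrow> real" and F :: "real \<Rightarrow> real" and h :: "nat \<Rightarrow> real"
  assumes h: "\<And>n. 0 < h n" "h \<longlonglongrightarrow> 0" and N: "\<And>n. h n * real (N n) = t" and t: "0 < t"
    and \<kappa>: "\<And>n. \<kappa> n \<le> N n" "(\<lambda>n. real (\<kappa> n) * h n) \<longlonglongrightarrow> s"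
    and bound: "\<forall>\<^sub>F n in sequentially. \<forall>j<N n. \<bar>f n j\<bar> \<le> C"
    and F: "continuous_on {0..t} F"
    and lim: "\<And>i u. (\<And>n. i n < N n) \<Longrightarrow> (\<lambda>n. real (i n) * h n) \<longlonglongrightarrow> u \<Longrightarrow> (\<lambda>n. f n (i n)) \<longlonglongrightarrow> F u"
  shows "(\<lambda>n. h n * (\<Sum>j<\<kappa> n. f n j)) \<longlonglongrightarrow> integral {0..s} F"
proof -
  obtain n0 where n0: "\<And>n j. n \<ge> n0 \<Longrightarrow> j < N n \<Longrightarrow> \<bar>f n j\<bar> \<le> C"
    using bound unfolding eventually_sequentially by blast
  have Npos: "0 < N n" for n using N[of n] t by (intro gr0I) auto
  have C: "0 \<le> C" using n0[of n0 0] Npos[of n0] by force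
  have s: "0 \<le> s" "s \<le> t"
  proof -
    show "0 \<le> s" by (rule tendsto_lowerbound[OF \<kappa>(2)]) (auto simp: less_imp_le[OF h(1)])
    have "real (\<kappa> n) * h n \<le> t" for n
      using mult_right_mono[of "real (\<kappa> n)" "real (N n)" "h n"] \<kappa>(1)[of n] h(1)[of n] N[of n]
      by (simp add: mult.commute)
    then show "s \<le> t" by (intro tendsto_upperbound[OF \<kappa>(2)]) auto
  qed
  let ?I = "\<lambda>n j. {real j * h n..<real (Suc j) * h n}"
  \<comment> \<open>Set to 0 below \<open>n0\<close>, so that the bound \<open>C\<close>, which
    holds only eventually, dominates every member of the sequence.\<close>
  define g where "g n u = (if n0 \<le> n then \<Sum>j<\<kappa> n. f n j * indicator (?I n j) u else 0)" for n u
  have cell: "indicator (?I n j) u = (if 0 \<le> u \<and> j = nat \<lfloor>u / h n\<rfloor> then 1 else 0 :: real)" for n j u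
  proof -
    have "u \<in> ?I n j \<longleftrightarrow> real j \<le> u / h n \<and> u / h n < real j + 1"
      using h(1)[of n] by (auto simp: field_simps)
    also have "\<dots> \<longleftrightarrow> \<lfloor>u / h n\<rfloor> = int j"
      by (auto simp: floor_eq_iff)
    also have "\<dots> \<longleftrightarrow> 0 \<le> u \<and> j = nat \<lfloor>u / h n\<rfloor>"
    proof -
      have "0 \<le> \<lfloor>u / h n\<rfloor> \<longleftrightarrow> 0 \<le> u" using h(1)[of n] by (simp add: zero_le_divide_iff)
      then show ?thesis by (metis nat_eq_iff2 of_nat_0_le_iff nat_int)
    qed
    finally show ?thesis by (simp add: indicator_def)
  qed
  have g_eq: "g n u = (if n0 \<le> n \<and> 0 \<le> u \<and> nat \<lfloor>u / h n\<rfloor> < \<kappa> n then f n (nat \<lfloor>u / h n\<rfloor>) else 0)" for n u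
    unfolding g_def cell by (auto simp: if_distrib sum.delta cong: if_cong)
  have small: "nat \<lfloor>u / h n\<rfloor> < \<kappa> n \<longleftrightarrow> u < real (\<kappa> n) * h n" if "0 \<le> u" for n u
  proof -
    have "nat \<lfloor>u / h n\<rfloor> < \<kappa> n \<longleftrightarrow> \<lfloor>u / h n\<rfloor> < int (\<kappa> n)"
      using that h(1)[of n] by (subst nat_less_iff) (auto simp: zero_le_divide_iff)
    also have "\<dots> \<longleftrightarrow> u / h n < real (\<kappa> n)" by (simp add: floor_less_iff)
    also have "\<dots> \<longleftrightarrow> u < real (\<kappa> n) * h n" using h(1)[of n] by (simp add: divide_less_eq)
    finally show ?thesis .
  qed
  have dom: "norm (g n u) \<le> C * indicator {0..t} u" for n u
  proof (cases "n0 \<le> n \<and> 0 \<le> u \<and> nat \<lfloor>u / h n\<rfloor> < \<kappa> n")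
    case True
    then have "nat \<lfloor>u / h n\<rfloor> < N n" using \<kappa>(1)[of n] by simp
    moreover have "u \<le> t"
    proof -
      have "real (\<kappa> n) * h n \<le> real (N n) * h n" using \<kappa>(1)[of n] h(1)[of n] by simp
      then show ?thesis using True small[of u n] N[of n] by (simp add: mult.commute)
    qed
    ultimately show ?thesis using True n0[of n "nat \<lfloor>u / h n\<rfloor>"] by (simp add: g_eq)
  qed (use C in \<open>auto simp: g_eq\<close>)
  \<comment> \<open>At \<open>u = s\<close> itself the upper end
    \<open>real (\<kappa> n) * h n\<close> may lie on either side of \<open>u\<close> as
    \<open>n\<close> varies, so convergence can fail; a single point is a null set.\<close>
  have pointwise: "(\<lambda>n. g n u) \<longlonglongrightarrow> indicator {0..s} u * F u" if "u \<noteq> s" for u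
  proof -
    have "u < 0 \<or> s < u \<or> 0 \<le> u \<and> u < s" using that by auto
    then consider "u < 0" | "s < u" | "0 \<le> u" "u < s" by blast
    then show ?thesis
    proof cases
      case 1
      then show ?thesis by (simp add: g_eq)
    next
      case 2
      then have "\<forall>\<^sub>F n in sequentially. real (\<kappa> n) * h n < u"
        by (rule order_tendstoD(2)[OF \<kappa>(2)])
      then have "\<forall>\<^sub>F n in sequentially. g n u = 0"
        by eventually_elim (use small in \<open>force simp: g_eq\<close>)
      then show ?thesis using 2 by (simp add: tendsto_eventually)
    next
      case 3
      \<comment> \<open>The cap at \<open>N n - 1\<close> makes \<open>i n\<close> an admissible
        index for every \<open>n\<close>, as \<open>lim\<close> demands; because
        \<open>u < s\<close>, it is inactive eventually.\<close>
      define i where "i n = min (nat \<lfloor>u / h n\<rfloor>) (N n - 1)" for n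
      have "\<forall>\<^sub>F n in sequentially. u < real (\<kappa> n) * h n"
        by (rule order_tendstoD(1)[OF \<kappa>(2) 3(2)])
      then have ev: "\<forall>\<^sub>F n in sequentially. i n = nat \<lfloor>u / h n\<rfloor> \<and> nat \<lfloor>u / h n\<rfloor> < \<kappa> n"
      proof eventually_elim
        case (elim n)
        then have "nat \<lfloor>u / h n\<rfloor> < \<kappa> n" using small 3 by blast
        then show ?case using \<kappa>(1)[of n] by (simp add: i_def)
      qed
      have "(\<lambda>n. real (i n) * h n) \<longlonglongrightarrow> u"
        by (rule Lim_transform_eventually[OF floor_grid_tendsto[OF h 3(1)]])
          (use ev in eventually_elim, simp)
      then have "(\<lambda>n. f n (i n)) \<longlonglongrightarrow> F u"
        by (intro lim) (use Npos in \<open>auto simp: i_def min_less_iff_disj\<close>)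
      moreover have "\<forall>\<^sub>F n in sequentially. f n (i n) = g n u"
        using ev eventually_ge_at_top[of n0] by eventually_elim (use 3 in \<open>simp add: g_eq\<close>)
      ultimately have "(\<lambda>n. g n u) \<longlonglongrightarrow> F u" by (rule Lim_transform_eventually)
      then show ?thesis using 3 by simp
    qed
  qed
  have int_F: "set_integrable lborel {0..s} F"
    by (rule borel_integrable_atLeastAtMost') (rule continuous_on_subset[OF F], use s in auto)
  have "(\<lambda>n. integral\<^sup>L lborel (g n)) \<longlonglongrightarrow> (\<integral>u. indicator {0..s} u * F u \<partial>lborel)"
  proof (rule integral_dominated_convergence)
    show "(\<lambda>u. indicator {0..s} u * F u) \<in> borel_measurable lborel"
      using int_F by (auto simp: set_integrable_def dest: borel_measurable_integrable)
    show "integrable lborel (\<lambda>u. C * indicator {0..t} u)"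
      using t by (intro integrable_mult_right integrable_real_indicator) auto
    show "AE u in lborel. (\<lambda>n. g n u) \<longlonglongrightarrow> indicator {0..s} u * F u"
      using AE_lborel_singleton[of s] by eventually_elim (rule pointwise)
    show "g n \<in> borel_measurable lborel" for n unfolding g_def by measurable
  qed (use dom in auto)
  moreover have "(\<integral>u. indicator {0..s} u * F u \<partial>lborel) = integral {0..s} F"
    using set_borel_integral_eq_integral(2)[OF int_F] by (simp add: set_lebesgue_integral_def)
  moreover have "\<forall>\<^sub>F n in sequentially. integral\<^sup>L lborel (g n) = h n * (\<Sum>j<\<kappa> n. f n j)"
    using eventually_ge_at_top[of n0]
  proof eventually_elim
    case (elim n)
    have "integral\<^sup>L lborel (g n) = (\<integral>u. (\<Sum>j<\<kappa> n. f n j * indicator (?I n j) u) \<partial>lborel)"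
      using elim by (intro arg_cong[where f = "integral\<^sup>L lborel"]) (simp add: g_def fun_eq_iff)
    also have "\<dots> = (\<Sum>j<\<kappa> n. \<integral>u. f n j * indicator (?I n j) u \<partial>lborel)"
    proof (intro Bochner_Integration.integral_sum integrable_mult_right integrable_real_indicator)
      fix j
      have "real j * h n \<le> real (Suc j) * h n" using h(1)[of n] by simp
      then show "emeasure lborel (?I n j) < \<infinity>" by simp
    qed auto
    also have "\<dots> = (\<Sum>j<\<kappa> n. f n j * measure lborel (?I n j))"
      by (simp del: of_nat_Suc)
    also have "\<dots> = (\<Sum>j<\<kappa> n. f n j * h n)"
    proof (rule sum.cong)
      fix j
      have "real j * h n \<le> real (Suc j) * h n" using h(1)[of n] by simp
      then show "f n j * measure lborel (?I n j) = f n j * h n"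
        by (simp add: algebra_simps)
    qed simp
    finally show ?case by (simp add: sum_distrib_left mult.commute)
  qed
  ultimately show ?thesis by (simp add: Lim_transform_eventually)
qed

section \<open>The transformation of one deterministic positive path\<close>

locale path_grid =
  fixes x :: "real \<Rightarrow> real" and c t :: real and h :: "nat \<Rightarrow> real" and N :: "nat \<Rightarrow> nat"
  assumes x_cont: "continuous_on {0..t} x" and x_pos: "\<And>s. 0 \<le> s \<Longrightarrow> s \<le> t \<Longrightarrow> 0 < x s"
    and t: "0 < t"
    and h: "\<And>n. 0 < h n" "h \<longlonglongrightarrow> 0" and N: "\<And>n. h n * real (N n) = t"
    and dom: "c * integral {0..t} x < 1"
begin

definition A :: "real \<Rightarrow> real" where "A s = integral {0..s} x"
definition D :: "real \<Rightarrow> real" where "D s = 1 - c * A s"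
definition xg :: "nat \<Rightarrow> nat \<Rightarrow> real" where "xg n k = x (real k * h n)"
definition Ag :: "nat \<Rightarrow> nat \<Rightarrow> real" where "Ag n k = h n * (\<Sum>j<k. xg n j)"
definition Dg :: "nat \<Rightarrow> nat \<Rightarrow> real" where "Dg n k = 1 - c * Ag n k"
text \<open>Grid version of \<open>2 * c * x / D\<close>, the derivative of
  \<open>- 2 * ln D\<close>. Adding its integral to \<open>ln x\<close> produces the path
  \<open>x / D\<^sup>2\<close>, since \<open>D 0 = 1\<close>.\<close>

definition \<theta>g :: "nat \<Rightarrow> nat \<Rightarrow> real" where "\<theta>g n k = 2 * c * xg n k / Dg n k"

lemma node_mem: "k \<le> N n \<Longrightarrow> real k * h n \<in> {0..t}"
  using mult_right_mono[of "real k" "real (N n)" "h n"] h(1)[of n] N[of n] by (simp add: mult.commute)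

lemma node_lim_mem:
  assumes "\<And>n. \<kappa> n \<le> N n" "(\<lambda>n. real (\<kappa> n) * h n) \<longlonglongrightarrow> s"
  shows "s \<in> {0..t}"
  by (rule closed_sequentially[OF closed_atLeastAtMost _ assms(2)]) (use node_mem[OF assms(1)] in auto)

lemma xg_pos: "k \<le> N n \<Longrightarrow> 0 < xg n k"
  using node_mem[of k n] x_pos by (auto simp: xg_def)

lemma xg_lim:
  assumes "\<And>n. \<kappa> n \<le> N n" "(\<lambda>n. real (\<kappa> n) * h n) \<longlonglongrightarrow> s"
  shows "(\<lambda>n. xg n (\<kappa> n)) \<longlonglongrightarrow> x s"
  unfolding xg_def
  by (rule continuous_on_tendsto_compose[OF x_cont assms(2) node_lim_mem[OF assms]])
    (use node_mem[OF assms(1)] in auto)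

lemma x_bounded: obtains K where "0 < K" "\<And>s. s \<in> {0..t} \<Longrightarrow> x s \<le> K" "\<And>n k. k \<le> N n \<Longrightarrow> xg n k \<le> K"
proof -
  have "bounded (x ` {0..t})"
    by (intro compact_imp_bounded compact_continuous_image x_cont) auto
  then obtain K where K: "K > 0" "\<And>s. s \<in> {0..t} \<Longrightarrow> \<bar>x s\<bar> \<le> K"
    unfolding bounded_pos by auto
  show thesis
  proof (rule that[of K])
    show "x s \<le> K" if "s \<in> {0..t}" for s using K(2)[OF that] by simp
    show "xg n k \<le> K" if "k \<le> N n" for n k using K(2)[OF node_mem[OF that]] by (simp add: xg_def)
  qed (rule K)
qed

lemma Ag_lim:
  assumes "\<And>n. \<kappa> n \<le> N n" "(\<lambda>n. real (\<kappa> n) * h n) \<longlonglongrightarrow> s"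
  shows "(\<lambda>n. Ag n (\<kappa> n)) \<longlonglongrightarrow> A s"
proof -
  obtain K where K: "\<And>n k. k \<le> N n \<Longrightarrow> xg n k \<le> K" using x_bounded by metis
  show ?thesis unfolding Ag_def A_def
  proof (rule grid_sum_tendsto_integral[OF h N t assms _ x_cont])
    show "\<forall>\<^sub>F n in sequentially. \<forall>j<N n. \<bar>xg n j\<bar> \<le> K"
      using K xg_pos by (auto simp: abs_of_pos)
  qed (auto intro!: xg_lim less_imp_le)
qed

lemma Ag_mono: "k \<le> l \<Longrightarrow> l \<le> N n \<Longrightarrow> Ag n k \<le> Ag n l"
  unfolding Ag_def using h(1)[of n]
  by (intro mult_left_mono sum_mono2) (auto intro!: less_imp_le xg_pos)

lemma Ag_nonneg: "l \<le> N n \<Longrightarrow> 0 \<le> Ag n l"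
  using Ag_mono[of 0 l n] by (simp add: Ag_def)

lemma x_integrable: "0 \<le> r \<Longrightarrow> s \<le> t \<Longrightarrow> x integrable_on {r..s}"
  by (rule integrable_continuous_interval) (rule continuous_on_subset[OF x_cont], auto)

lemma A_mono:
  assumes "0 \<le> r" "r \<le> s" "s \<le> t"
  shows "A r \<le> A s"
  unfolding A_def
proof (rule integral_subset_le)
  show "\<forall>u\<in>{0..s}. 0 \<le> x u"
  proof
    fix u assume "u \<in> {0..s}"
    then show "0 \<le> x u" using x_pos[of u] assms by simp
  qed
qed (use assms in \<open>auto intro!: x_integrable\<close>)

lemma A_nonneg: "0 \<le> s \<Longrightarrow> s \<le> t \<Longrightarrow> 0 \<le> A s"
  using A_mono[of 0 s] by (simp add: A_def)

lemma end_node: "(\<lambda>n. real (N n) * h n) \<longlonglongrightarrow> t"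
  using N by (simp add: mult.commute)

text \<open>For \<open>c \<le> 0\<close>, \<open>D\<close> never falls below 1. For
  \<open>c > 0\<close> it decreases, so its minimum is \<open>D t\<close>, positive by
  \<open>dom\<close>; on the grid, monotonicity of \<open>Ag\<close> reduces the uniform bound to
  convergence at the end node, and the factor 1/2 leaves room for that limit.\<close>

lemma D_lower_bound:
  obtains \<epsilon> where "0 < \<epsilon>" "\<And>s. s \<in> {0..t} \<Longrightarrow> \<epsilon> \<le> D s"
    "\<forall>\<^sub>F n in sequentially. \<forall>k\<le>N n. \<epsilon> \<le> Dg n k"
proof (cases "c \<le> 0")
  case True
  show thesis
  proof (rule that[of 1])
    show "1 \<le> D s" if "s \<in> {0..t}" for s
      using that True A_nonneg[of s] by (simp add: D_def mult_nonpos_nonneg)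
    show "\<forall>\<^sub>F n in sequentially. \<forall>k\<le>N n. 1 \<le> Dg n k"
      using True Ag_nonneg by (simp add: Dg_def mult_nonpos_nonneg)
  qed simp
next
  case False
  have Dt: "0 < D t" using dom by (simp add: D_def A_def)
  show thesis
  proof (rule that[of "D t / 2"])
    show "0 < D t / 2" using Dt by simp
    show "D t / 2 \<le> D s" if "s \<in> {0..t}" for s
    proof -
      have "D t \<le> D s" using that False A_mono[of s t] by (simp add: D_def)
      then show ?thesis using Dt by simp
    qed
    have "(\<lambda>n. Dg n (N n)) \<longlonglongrightarrow> D t"
      unfolding Dg_def D_def by (intro tendsto_intros Ag_lim end_node) auto
    then have "\<forall>\<^sub>F n in sequentially. D t / 2 < Dg n (N n)"
      by (rule order_tendstoD) (use Dt in simp)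
    then show "\<forall>\<^sub>F n in sequentially. \<forall>k\<le>N n. D t / 2 \<le> Dg n k"
    proof eventually_elim
      case (elim n)
      show ?case
      proof safe
        fix k assume "k \<le> N n"
        then have "c * Ag n k \<le> c * Ag n (N n)" using False Ag_mono[of k "N n" n] by simp
        then show "D t / 2 \<le> Dg n k" using elim by (simp add: Dg_def)
      qed
    qed
  qed
qed

lemma D_pos: "s \<in> {0..t} \<Longrightarrow> 0 < D s"
  by (rule D_lower_bound) force

lemma Dg_lim:
  assumes "\<And>n. \<kappa> n \<le> N n" "(\<lambda>n. real (\<kappa> n) * h n) \<longlonglongrightarrow> s"
  shows "(\<lambda>n. Dg n (\<kappa> n)) \<longlonglongrightarrow> D s"
  unfolding Dg_def D_def by (intro tendsto_intros Ag_lim assms)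

lemma \<theta>g_lim:
  assumes "\<And>n. \<kappa> n \<le> N n" "(\<lambda>n. real (\<kappa> n) * h n) \<longlonglongrightarrow> s"
  shows "(\<lambda>n. \<theta>g n (\<kappa> n)) \<longlonglongrightarrow> 2 * c * x s / D s"
  unfolding \<theta>g_def
  using D_pos[OF node_lim_mem[OF assms]] by (intro tendsto_intros xg_lim Dg_lim assms) auto

lemma A_deriv:
  assumes "s \<in> {0..t}" shows "(A has_real_derivative x s) (at s within {0..t})"
  unfolding A_def[abs_def] by (rule integral_has_real_derivative[OF x_cont assms])

lemma A_cont: "continuous_on {0..t} A"
  using A_deriv by (meson DERIV_continuous_on)

lemma D_cont: "continuous_on {0..t} D"
  unfolding D_def[abs_def] by (intro continuous_intros A_cont)

lemma D_deriv:
  assumes "s \<in> {0..t}" shows "(D has_real_derivative - (c * x s)) (at s within {0..t})"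
  unfolding D_def[abs_def] using A_deriv[OF assms] by (auto intro!: derivative_eq_intros)

lemma integral_log:
  assumes s: "s \<in> {0..t}"
  shows "integral {0..s} (\<lambda>u. 2 * c * x u / D u) = - 2 * ln (D s)"
proof -
  have "((\<lambda>u. 2 * c * x u / D u) has_integral (- 2 * ln (D s) - (- 2 * ln (D 0)))) {0..s}"
  proof (rule fundamental_theorem_of_calculus)
    fix u assume u: "u \<in> {0..s}"
    then have u': "u \<in> {0..t}" using s by auto
    have "((\<lambda>u. - 2 * ln (D u)) has_real_derivative 2 * c * x u / D u) (at u within {0..t})"
      using D_deriv[OF u'] D_pos[OF u'] by (auto intro!: derivative_eq_intros simp: field_simps)
    then show "((\<lambda>u. - 2 * ln (D u)) has_vector_derivative 2 * c * x u / D u) (at u within {0..s})"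
      unfolding has_real_derivative_iff_has_vector_derivative[symmetric]
      by (rule DERIV_subset) (use s in auto)
  qed (use s in auto)
  then show ?thesis by (auto simp: D_def A_def intro: integral_unique)
qed

text \<open>The derivative of \<open>A / D\<close> is \<open>x * (D + c * A) / D\<^sup>2\<close>,
  and \<open>D + c * A = 1\<close>. Hence the transformed path has functional \<open>A / D\<close>,
  whose reciprocal is \<open>1 / A - c\<close>.\<close>

lemma integral_quotient: "integral {0..t} (\<lambda>u. x u / (D u)\<^sup>2) = A t / D t"
proof -
  have "((\<lambda>u. x u / (D u)\<^sup>2) has_integral (A t / D t - A 0 / D 0)) {0..t}"
  proof (rule fundamental_theorem_of_calculus)
    fix u assume u: "u \<in> {0..t}"
    have "((\<lambda>u. A u / D u) has_real_derivative x u / (D u)\<^sup>2) (at u within {0..t})"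
    proof -
      have "(x u * D u - A u * - (c * x u)) = x u" by (simp add: D_def algebra_simps)
      then show ?thesis
        using DERIV_divide[OF A_deriv[OF u] D_deriv[OF u]] D_pos[OF u] by (simp add: power2_eq_square)
    qed
    then show "((\<lambda>u. A u / D u) has_vector_derivative x u / (D u)\<^sup>2) (at u within {0..t})"
      by (simp add: has_real_derivative_iff_has_vector_derivative)
  qed (use t in auto)
  then show ?thesis by (auto simp: A_def intro: integral_unique)
qed

lemma \<theta>g_bounded: obtains C where "\<forall>\<^sub>F n in sequentially. \<forall>k\<le>N n. \<bar>\<theta>g n k\<bar> \<le> C"
proof -
  obtain K where K: "0 < K" "\<And>n k. k \<le> N n \<Longrightarrow> xg n k \<le> K" using x_bounded by metis
  obtain \<epsilon> where \<epsilon>: "0 < \<epsilon>" "\<forall>\<^sub>F n in sequentially. \<forall>k\<le>N n. \<epsilon> \<le> Dg n k"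
    by (rule D_lower_bound)
  have "\<forall>\<^sub>F n in sequentially. \<forall>k\<le>N n. \<bar>\<theta>g n k\<bar> \<le> 2 * \<bar>c\<bar> * K / \<epsilon>"
    using \<epsilon>(2)
  proof eventually_elim
    case (elim n)
    show ?case
    proof safe
      fix k assume k: "k \<le> N n"
      have "\<bar>\<theta>g n k\<bar> = 2 * \<bar>c\<bar> * xg n k / Dg n k"
        using elim k \<epsilon>(1) xg_pos[OF k] by (force simp: \<theta>g_def abs_mult)
      also have "\<dots> \<le> 2 * \<bar>c\<bar> * K / \<epsilon>"
        using elim k \<epsilon>(1) xg_pos[OF k] K(2)[OF k] K(1) by (intro frac_le mult_left_mono) auto
      finally show "\<bar>\<theta>g n k\<bar> \<le> 2 * \<bar>c\<bar> * K / \<epsilon>" .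
    qed
  qed
  then show thesis by (rule that)
qed

lemma shift_lim:
  assumes "\<And>n. \<kappa> n \<le> N n" "(\<lambda>n. real (\<kappa> n) * h n) \<longlonglongrightarrow> s"
  shows "(\<lambda>n. h n * (\<Sum>j<\<kappa> n. \<theta>g n j)) \<longlonglongrightarrow> - 2 * ln (D s)"
proof -
  obtain C where C: "\<forall>\<^sub>F n in sequentially. \<forall>k\<le>N n. \<bar>\<theta>g n k\<bar> \<le> C" using \<theta>g_bounded .
  have "(\<lambda>n. h n * (\<Sum>j<\<kappa> n. \<theta>g n j)) \<longlonglongrightarrow> integral {0..s} (\<lambda>u. 2 * c * x u / D u)"
  proof (rule grid_sum_tendsto_integral[OF h N t assms])
    show "\<forall>\<^sub>F n in sequentially. \<forall>j<N n. \<bar>\<theta>g n j\<bar> \<le> C"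
      using C by eventually_elim auto
    show "continuous_on {0..t} (\<lambda>u. 2 * c * x u / D u)"
      using D_pos by (intro continuous_intros x_cont D_cont) force
  qed (auto intro!: \<theta>g_lim less_imp_le)
  then show ?thesis by (simp add: integral_log[OF node_lim_mem[OF assms]])
qed

text \<open>The inner sums converge along any convergent sequence of nodes by
  \<open>shift_lim\<close>, so the double sum still falls under
  \<open>grid_sum_tendsto_integral\<close>; the exponential factor tends to
  \<open>1 / (D u)\<^sup>2\<close>.\<close>

lemma shifted_functional_lim:
  "(\<lambda>n. h n * (\<Sum>j<N n. xg n j * exp (h n * (\<Sum>i<j. \<theta>g n i)))) \<longlonglongrightarrow> A t / D t"
proof -
  obtain C where C: "\<forall>\<^sub>F n in sequentially. \<forall>k\<le>N n. \<bar>\<theta>g n k\<bar> \<le> C" using \<theta>g_bounded .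
  obtain K where K: "0 < K" "\<And>n k. k \<le> N n \<Longrightarrow> xg n k \<le> K" using x_bounded by metis
  have "(\<lambda>n. h n * (\<Sum>j<N n. xg n j * exp (h n * (\<Sum>i<j. \<theta>g n i))))
      \<longlonglongrightarrow> integral {0..t} (\<lambda>u. x u / (D u)\<^sup>2)"
  proof (rule grid_sum_tendsto_integral[OF h N t])
    show "\<forall>\<^sub>F n in sequentially. \<forall>j<N n. \<bar>xg n j * exp (h n * (\<Sum>i<j. \<theta>g n i))\<bar> \<le> K * exp (t * C)"
      using C
    proof eventually_elim
      case (elim n)
      show ?case
      proof safe
        fix j assume j: "j < N n"
        have "0 \<le> C" using elim[rule_format, of 0] by simp
        have "h n * (\<Sum>i<j. \<theta>g n i) \<le> h n * (\<Sum>i<j. C)"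
          using elim j h(1)[of n] by (intro mult_left_mono sum_mono) (auto simp: abs_le_iff)
        also have "\<dots> = (real j * h n) * C" by simp
        also have "\<dots> \<le> t * C"
          using node_mem[of j n] j \<open>0 \<le> C\<close> by (intro mult_right_mono) auto
        finally have "xg n j * exp (h n * (\<Sum>i<j. \<theta>g n i)) \<le> K * exp (t * C)"
          using K(2)[of j n] j xg_pos[of j n] K(1) by (intro mult_mono) auto
        then show "\<bar>xg n j * exp (h n * (\<Sum>i<j. \<theta>g n i))\<bar> \<le> K * exp (t * C)"
          using xg_pos[of j n] j by (simp add: abs_mult)
      qed
    qed
    show "continuous_on {0..t} (\<lambda>u. x u / (D u)\<^sup>2)"
      using D_pos by (intro continuous_intros x_cont D_cont) force
    fix i :: "nat \<Rightarrow> nat" and u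
    assume i: "\<And>n. i n < N n" and iu: "(\<lambda>n. real (i n) * h n) \<longlonglongrightarrow> u"
    have i': "\<And>n. i n \<le> N n" using i by (simp add: less_imp_le)
    have "(\<lambda>n. xg n (i n) * exp (h n * (\<Sum>k<i n. \<theta>g n k))) \<longlonglongrightarrow> x u * exp (- 2 * ln (D u))"
      by (intro tendsto_intros xg_lim shift_lim i' iu)
    moreover have "exp (- 2 * ln (D u)) = 1 / (D u)\<^sup>2"
      using D_pos[OF node_lim_mem[OF i' iu]]
      by (simp add: exp_minus exp_double inverse_eq_divide)
    ultimately show "(\<lambda>n. xg n (i n) * exp (h n * (\<Sum>k<i n. \<theta>g n k))) \<longlonglongrightarrow> x u / (D u)\<^sup>2"
      by simp
  qed (auto intro: end_node)
  then show ?thesis by (simp add: integral_quotient)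
qed

section \<open>A discrete Ito formula for the weight\<close>

lemma exp_difference_quotient_lim: "(\<lambda>n. (exp (- \<nu> * h n) - 1) / h n) \<longlonglongrightarrow> - \<nu>"
proof -
  have "((\<lambda>y. exp (- \<nu> * y)) has_real_derivative - \<nu>) (at 0)"
    by (auto intro!: derivative_eq_intros)
  then have "((\<lambda>y. (exp (- \<nu> * y) - 1) / y) \<longlongrightarrow> - \<nu>) (at 0)"
    by (simp add: DERIV_def)
  moreover have "filterlim h (at 0) sequentially"
    using h(2) h(1) by (intro filterlim_atI) (auto simp: less_imp_neq[symmetric])
  ultimately show ?thesis by (rule filterlim_compose)
qed

lemma next_node_lim:
  assumes i: "\<And>n. i n < N n" and iu: "(\<lambda>n. real (i n) * h n) \<longlonglongrightarrow> u"
  shows "(\<lambda>n. real (Suc (i n)) * h n) \<longlonglongrightarrow> u"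
  using tendsto_add[OF iu h(2)] by (simp add: distrib_right add.commute)

text \<open>The product rule for \<open>2 * c * x / D\<close> on the grid. As
  \<open>Dg n (Suc j) = Dg n j - c * h n * xg n j\<close>, pairing \<open>xg n (Suc j)\<close> with
  \<open>Dg n j\<close> instead of \<open>Dg n (Suc j)\<close> costs the explicit product term;
  everything else telescopes. The factor \<open>e\<close> will be
  \<open>exp (- \<nu> * h n)\<close>, and its deviation from 1 produces the last sum.\<close>

lemma summation_by_parts:
  assumes Dg: "\<And>k. k \<le> N n \<Longrightarrow> Dg n k \<noteq> 0"
  shows "(\<Sum>j<N n. \<theta>g n j * (e * xg n (Suc j) / xg n j - 1))
    = 2 * c * xg n (N n) / Dg n (N n) - 2 * c * xg n 0
      - h n * (\<Sum>j<N n. 2 * c\<^sup>2 * xg n j * xg n (Suc j) / (Dg n j * Dg n (Suc j)))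
      + (e - 1) / h n * (h n * (\<Sum>j<N n. 2 * c * xg n (Suc j) / Dg n j))"
proof -
  let ?Y = "\<lambda>j. 2 * c * xg n j / Dg n j"
  have summand: "\<theta>g n j * (e * xg n (Suc j) / xg n j - 1)
    = (?Y (Suc j) - ?Y j) - h n * (2 * c\<^sup>2 * xg n j * xg n (Suc j) / (Dg n j * Dg n (Suc j)))
      + (e - 1) * (2 * c * xg n (Suc j) / Dg n j)" if j: "j < N n" for j
  proof -
    have 1: "xg n j \<noteq> 0" "Dg n j \<noteq> 0" "Dg n (Suc j) \<noteq> 0"
      using j Dg[of j] Dg[of "Suc j"] xg_pos[of j n] by auto
    have D': "Dg n (Suc j) = Dg n j - c * h n * xg n j"
      by (simp add: Dg_def Ag_def algebra_simps)
    have 2: "2 * c * xg n (Suc j) / Dg n (Suc j) - h n * (2 * c\<^sup>2 * xg n j * xg n (Suc j) / (Dg n j * Dg n (Suc j)))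
       = 2 * c * xg n (Suc j) / Dg n j"
    proof -
      have "2 * c * xg n (Suc j) / Dg n (Suc j) - h n * (2 * c\<^sup>2 * xg n j * xg n (Suc j) / (Dg n j * Dg n (Suc j)))
         = 2 * c * xg n (Suc j) * (Dg n j - c * h n * xg n j) / (Dg n j * Dg n (Suc j))"
        using 1 by (simp add: field_simps power2_eq_square)
      also have "\<dots> = 2 * c * xg n (Suc j) / Dg n j"
        unfolding D'[symmetric] using 1 by simp
      finally show ?thesis .
    qed
    have "\<theta>g n j * (e * xg n (Suc j) / xg n j - 1) = e * (2 * c * xg n (Suc j) / Dg n j) - ?Y j"
      using 1 by (simp add: \<theta>g_def field_simps)
    moreover have "(e - 1) * (2 * c * xg n (Suc j) / Dg n j)
        = e * (2 * c * xg n (Suc j) / Dg n j) - 2 * c * xg n (Suc j) / Dg n j"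
      by (simp only: left_diff_distrib mult_1_left)
    moreover have "T = Y' - Y - R + E" if "T = a - Y" "E = a - V" "Y' - R = V" for T Y Y' R E a V :: real
      using that by simp
    ultimately show ?thesis using 2 by blast
  qed
  have "(\<Sum>j<N n. \<theta>g n j * (e * xg n (Suc j) / xg n j - 1))
    = (\<Sum>j<N n. (?Y (Suc j) - ?Y j) - h n * (2 * c\<^sup>2 * xg n j * xg n (Suc j) / (Dg n j * Dg n (Suc j)))
      + (e - 1) * (2 * c * xg n (Suc j) / Dg n j))"
    by (intro sum.cong refl summand) auto
  also have "\<dots> = (?Y (N n) - ?Y 0)
      - h n * (\<Sum>j<N n. 2 * c\<^sup>2 * xg n j * xg n (Suc j) / (Dg n j * Dg n (Suc j)))
      + (e - 1) * (\<Sum>j<N n. 2 * c * xg n (Suc j) / Dg n j)"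
    by (subst sum.distrib, subst sum_subtractf, subst sum_lessThan_telescope) (simp only: sum_distrib_left)
  finally show ?thesis
    using h(1)[of n] by (simp add: Dg_def[of n 0] Ag_def)
qed

text \<open>The correction from \<open>summation_by_parts\<close> and half the squared drift share
  the limiting integrand \<open>2 * c\<^sup>2 * x\<^sup>2 / D\<^sup>2\<close> and enter with
  opposite signs, so they cancel (this is \<open>r\<close>). What survives are the boundary terms
  and, from \<open>v\<close>, a multiple of the logarithmic integral
  \<open>integral_log\<close>.\<close>

lemma weight_lim:
  "(\<lambda>n. (\<Sum>j<N n. \<theta>g n j * (exp (- \<nu> * h n) * xg n (Suc j) / xg n j - 1)) + h n / 2 * (\<Sum>j<N n. (\<theta>g n j)\<^sup>2))
    \<longlonglongrightarrow> 2 * c * x t / D t - 2 * c * x 0 + 2 * \<nu> * ln (D t)"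
proof -
  obtain K where K: "0 < K" "\<And>n k. k \<le> N n \<Longrightarrow> xg n k \<le> K" using x_bounded by metis
  obtain \<epsilon> where \<epsilon>: "0 < \<epsilon>" and D\<epsilon>: "\<forall>\<^sub>F n in sequentially. \<forall>k\<le>N n. \<epsilon> \<le> Dg n k"
    by (rule D_lower_bound)
  obtain C where C: "\<forall>\<^sub>F n in sequentially. \<forall>k\<le>N n. \<bar>\<theta>g n k\<bar> \<le> C" using \<theta>g_bounded .
  define r where "r n j = (\<theta>g n j)\<^sup>2 / 2 - 2 * c\<^sup>2 * xg n j * xg n (Suc j) / (Dg n j * Dg n (Suc j))" for n j
  define v where "v n j = 2 * c * xg n (Suc j) / Dg n j" for n j
  have r_lim: "(\<lambda>n. h n * (\<Sum>j<N n. r n j)) \<longlonglongrightarrow> integral {0..t} (\<lambda>_. 0)"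
  proof (rule grid_sum_tendsto_integral[OF h N t])
    show "\<forall>\<^sub>F n in sequentially. \<forall>j<N n. \<bar>r n j\<bar> \<le> C\<^sup>2 / 2 + 2 * c\<^sup>2 * K * K / (\<epsilon> * \<epsilon>)"
      using C D\<epsilon>
    proof eventually_elim
      case (elim n)
      show ?case
      proof safe
        fix j assume j: "j < N n"
        have "(\<theta>g n j)\<^sup>2 \<le> C\<^sup>2"
          using elim(1) j by (intro abs_le_square_iff[THEN iffD1]) (force intro: order.trans[OF _ abs_ge_self])
        moreover have "2 * c\<^sup>2 * xg n j * xg n (Suc j) / (Dg n j * Dg n (Suc j)) \<le> 2 * c\<^sup>2 * K * K / (\<epsilon> * \<epsilon>)"
        proof -
          have "\<epsilon> \<le> Dg n j" "\<epsilon> \<le> Dg n (Suc j)" using elim(2) j by auto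
          then show ?thesis
            using \<epsilon> K(1) K(2)[of j n] K(2)[of "Suc j" n] xg_pos[of j n] xg_pos[of "Suc j" n] j
            by (intro frac_le mult_mono mult_left_mono) auto
        qed
        moreover have "0 \<le> 2 * c\<^sup>2 * xg n j * xg n (Suc j) / (Dg n j * Dg n (Suc j))"
        proof -
          have "\<epsilon> \<le> Dg n j" "\<epsilon> \<le> Dg n (Suc j)" using elim(2) j by auto
          then show ?thesis using \<epsilon> xg_pos[of j n] xg_pos[of "Suc j" n] j by simp
        qed
        moreover have "0 \<le> (\<theta>g n j)\<^sup>2" by simp
        ultimately show "\<bar>r n j\<bar> \<le> C\<^sup>2 / 2 + 2 * c\<^sup>2 * K * K / (\<epsilon> * \<epsilon>)"
          unfolding r_def by linarith
      qed
    qed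
    fix i :: "nat \<Rightarrow> nat" and u
    assume i: "\<And>n. i n < N n" and iu: "(\<lambda>n. real (i n) * h n) \<longlonglongrightarrow> u"
    have i': "\<And>n. i n \<le> N n" "\<And>n. Suc (i n) \<le> N n" using i by (auto simp: less_imp_le Suc_le_eq)
    note iu' = next_node_lim[OF i iu]
    have Du: "D u \<noteq> 0" using D_pos[OF node_lim_mem[OF i'(1) iu]] by simp
    have "(\<lambda>n. r n (i n)) \<longlonglongrightarrow> (2 * c * x u / D u)\<^sup>2 / 2 - 2 * c\<^sup>2 * x u * x u / (D u * D u)"
      unfolding r_def using Du by (intro tendsto_intros \<theta>g_lim xg_lim Dg_lim i' iu iu') auto
    moreover have "(2 * c * x u / D u)\<^sup>2 / 2 - 2 * c\<^sup>2 * x u * x u / (D u * D u) = 0"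
      by (simp add: power2_eq_square)
    ultimately show "(\<lambda>n. r n (i n)) \<longlonglongrightarrow> 0" by simp
  qed (auto intro: end_node)
  have v_lim: "(\<lambda>n. h n * (\<Sum>j<N n. v n j)) \<longlonglongrightarrow> integral {0..t} (\<lambda>u. 2 * c * x u / D u)"
  proof (rule grid_sum_tendsto_integral[OF h N t])
    show "\<forall>\<^sub>F n in sequentially. \<forall>j<N n. \<bar>v n j\<bar> \<le> 2 * \<bar>c\<bar> * K / \<epsilon>"
      using D\<epsilon>
    proof eventually_elim
      case (elim n)
      show ?case
      proof safe
        fix j assume j: "j < N n"
        have D: "\<epsilon> \<le> Dg n j" using elim j by simp
        have "\<bar>v n j\<bar> = 2 * \<bar>c\<bar> * xg n (Suc j) / Dg n j"
          using D \<epsilon> j xg_pos[of "Suc j" n] by (simp add: v_def abs_mult)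
        also have "\<dots> \<le> 2 * \<bar>c\<bar> * K / \<epsilon>"
          using D \<epsilon> j xg_pos[of "Suc j" n] K by (intro frac_le mult_left_mono) auto
        finally show "\<bar>v n j\<bar> \<le> 2 * \<bar>c\<bar> * K / \<epsilon>" .
      qed
    qed
    show "continuous_on {0..t} (\<lambda>u. 2 * c * x u / D u)"
      using D_pos by (intro continuous_intros x_cont D_cont) force
    fix i :: "nat \<Rightarrow> nat" and u
    assume i: "\<And>n. i n < N n" and iu: "(\<lambda>n. real (i n) * h n) \<longlonglongrightarrow> u"
    have i': "\<And>n. i n \<le> N n" "\<And>n. Suc (i n) \<le> N n" using i by (auto simp: less_imp_le Suc_le_eq)
    note iu' = next_node_lim[OF i iu]
    have Du: "D u \<noteq> 0" using D_pos[OF node_lim_mem[OF i'(1) iu]] by simp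
    show "(\<lambda>n. v n (i n)) \<longlonglongrightarrow> 2 * c * x u / D u"
      unfolding v_def using Du by (intro tendsto_intros xg_lim Dg_lim i' iu iu') auto
  qed (auto intro: end_node)
  have L: "(\<lambda>n. (2 * c * xg n (N n) / Dg n (N n) - 2 * c * xg n 0) + h n * (\<Sum>j<N n. r n j)
      + (exp (- \<nu> * h n) - 1) / h n * (h n * (\<Sum>j<N n. v n j)))
    \<longlonglongrightarrow> (2 * c * x t / D t - 2 * c * x 0) + integral {0..t} (\<lambda>_. 0)
      + - \<nu> * integral {0..t} (\<lambda>u. 2 * c * x u / D u)"
    using D_pos[of t] t
    by (intro tendsto_intros xg_lim Dg_lim r_lim v_lim exp_difference_quotient_lim end_node) auto
  have L_eq: "(2 * c * x t / D t - 2 * c * x 0) + integral {0..t} (\<lambda>_. 0)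
      + - \<nu> * integral {0..t} (\<lambda>u. 2 * c * x u / D u) = 2 * c * x t / D t - 2 * c * x 0 + 2 * \<nu> * ln (D t)"
    using integral_log[of t] t by simp
  have ev: "\<forall>\<^sub>F n in sequentially.
      (2 * c * xg n (N n) / Dg n (N n) - 2 * c * xg n 0) + h n * (\<Sum>j<N n. r n j)
      + (exp (- \<nu> * h n) - 1) / h n * (h n * (\<Sum>j<N n. v n j))
    = (\<Sum>j<N n. \<theta>g n j * (exp (- \<nu> * h n) * xg n (Suc j) / xg n j - 1)) + h n / 2 * (\<Sum>j<N n. (\<theta>g n j)\<^sup>2)"
    using D\<epsilon>
  proof eventually_elim
    case (elim n)
    have "Dg n k \<noteq> 0" if "k \<le> N n" for k using elim that \<epsilon> by force
    note parts = summation_by_parts[OF this, of "exp (- \<nu> * h n)"]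
    have r_sum: "h n * (\<Sum>j<N n. r n j) = h n / 2 * (\<Sum>j<N n. (\<theta>g n j)\<^sup>2)
       - h n * (\<Sum>j<N n. 2 * c\<^sup>2 * xg n j * xg n (Suc j) / (Dg n j * Dg n (Suc j)))"
      by (simp add: r_def sum_subtractf right_diff_distrib sum_divide_distrib[symmetric])
    have combine: "a - b + R + E = T + Q" if "R = Q - P" "T = a - b - P + E" for a b P Q R E T :: real
      using that by simp
    from combine[OF r_sum parts] show ?case unfolding v_def .
  qed
  show ?thesis by (rule Lim_transform_eventually[OF L[unfolded L_eq] ev])
qed

text \<open>On a fixed path in the domain, \<open>xg\<close> is bounded and \<open>Dg\<close> is
  eventually bounded away from 0, so a truncation at levels tending to infinity is eventually
  invisible.\<close>

lemma eventually_untruncated: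
  assumes "filterlim m at_top sequentially"
  shows "\<forall>\<^sub>F n in sequentially. \<forall>k\<le>N n. xg n k \<le> m n \<and> 1 / m n \<le> Dg n k"
proof -
  obtain K where K: "0 < K" "\<And>n k. k \<le> N n \<Longrightarrow> xg n k \<le> K" using x_bounded by metis
  obtain \<epsilon> where \<epsilon>: "0 < \<epsilon>" and D\<epsilon>: "\<forall>\<^sub>F n in sequentially. \<forall>k\<le>N n. \<epsilon> \<le> Dg n k"
    by (rule D_lower_bound)
  have "\<forall>\<^sub>F n in sequentially. max K (1 / \<epsilon>) \<le> m n"
    using assms unfolding filterlim_at_top by blast
  with D\<epsilon> show ?thesis
  proof eventually_elim
    case (elim n)
    have "1 / m n \<le> \<epsilon>"
      using elim(2) \<epsilon> K(1) by (simp add: field_simps)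
    then show ?case using elim K(2)[of _ n] by (auto intro: order.trans)
  qed
qed

end

section \<open>Discretised Brownian motion\<close>

context brownian_motion begin

lemma geom_BM_continuous:
  assumes "\<omega> \<in> space M" shows "continuous_on {0..t} (\<lambda>s. geom_BM B \<nu> s \<omega>)"
  unfolding geom_BM_def
  by (intro continuous_intros continuous_on_subset[OF continuous_paths[OF assms]]) auto

lemma exp_functional_eq_integral:
  assumes "\<omega> \<in> space M"
  shows "exp_functional B \<nu> t \<omega> = integral {0..t} (\<lambda>s. geom_BM B \<nu> s \<omega>)"
  unfolding exp_functional_def
  by (intro set_borel_integral_eq_integral(2) borel_integrable_atLeastAtMost' geom_BM_continuous assms)

end

lemma exp_functional_nonneg: "0 \<le> exp_functional B \<nu> t \<omega>"
  unfolding exp_functional_def set_lebesgue_integral_def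
  by (intro Bochner_Integration.integral_nonneg) (simp add: geom_BM_def)

locale BM_grid = brownian_motion +
  fixes \<nu> c t :: real
  assumes t: "0 < t"
begin

text \<open>With \<^term>\<open>(n + 1) ^ 6\<close> steps and the drift truncated at level \<^term>\<open>n + 1\<close>, the second
  moment of the martingale \<open>mart\<close> below is of order \<open>(n + 1) ^ 4 / (n + 1) ^ 6\<close>, which is summable.\<close>

definition steps :: "nat \<Rightarrow> nat" where "steps n = (n + 1) ^ 6"
definition mesh :: "nat \<Rightarrow> real" where "mesh n = t / real (steps n)"
definition \<xi> :: "nat \<Rightarrow> nat \<Rightarrow> 'a \<Rightarrow> real" where
  "\<xi> n k \<omega> = B (real (Suc k) * mesh n) \<omega> - B (real k * mesh n) \<omega>"
text \<open>Summing increments, rather than evaluating \<open>B\<close>, gives the deterministic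
  initial state required by \<open>discrete_girsanov\<close>, although \<open>B 0\<close> vanishes
  only almost surely.\<close>

definition pos :: "nat \<Rightarrow> nat \<Rightarrow> 'a \<Rightarrow> real" where
  "pos n k \<omega> = (\<Sum>j<k. \<xi> n j \<omega> + (\<nu> - 1 / 2) * mesh n)"
definition area :: "nat \<Rightarrow> nat \<Rightarrow> 'a \<Rightarrow> real" where
  "area n k \<omega> = mesh n * (\<Sum>j<k. exp (pos n j \<omega>))"
text \<open>The drift \<open>2 * c * X / (1 - c * A)\<close>, set to 0 where \<open>X\<close> is
  large or \<open>1 - c * A\<close> is not safely positive. Truncation is not for Girsanov's
  formula, which holds on the grid for any measurable drift, but for the second moment bound, which
  needs a bounded one. It looks only at the current state, so the recursion structure is
  kept.\<close>

definition drift :: "nat \<Rightarrow> real \<times> real \<Rightarrow> real" where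
  "drift n p = (if exp (fst p) \<le> real (n + 1) \<and> 1 / real (n + 1) \<le> 1 - c * snd p
     then 2 * c * exp (fst p) / (1 - c * snd p) else 0)"
definition dr :: "nat \<Rightarrow> nat \<Rightarrow> 'a \<Rightarrow> real" where
  "dr n k \<omega> = drift n (pos n k \<omega>, area n k \<omega>)"
definition pos' :: "nat \<Rightarrow> nat \<Rightarrow> 'a \<Rightarrow> real" where
  "pos' n k \<omega> = pos n k \<omega> + mesh n * (\<Sum>j<k. dr n j \<omega>)"
definition area' :: "nat \<Rightarrow> nat \<Rightarrow> 'a \<Rightarrow> real" where
  "area' n k \<omega> = mesh n * (\<Sum>j<k. exp (pos' n j \<omega>))"
definition wt :: "nat \<Rightarrow> nat \<Rightarrow> 'a \<Rightarrow> real" where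
  "wt n k \<omega> = (\<Sum>j<k. - dr n j \<omega> * \<xi> n j \<omega> - mesh n * (dr n j \<omega>)\<^sup>2 / 2)"
definition mart :: "nat \<Rightarrow> nat \<Rightarrow> 'a \<Rightarrow> real" where
  "mart n k \<omega> = (\<Sum>j<k. dr n j \<omega> * (exp (\<xi> n j \<omega> - mesh n / 2) - 1 - \<xi> n j \<omega>))"
definition grid_step :: "nat \<Rightarrow> real \<times> real \<Rightarrow> real \<Rightarrow> real \<times> real" where
  "grid_step n p x = (fst p + (x + (\<nu> - 1 / 2) * mesh n), snd p + mesh n * exp (fst p))"

lemma steps_pos: "0 < steps n" by (simp add: steps_def)

lemma mesh_pos: "0 < mesh n" using t steps_pos by (simp add: mesh_def)

lemma mesh_steps: "mesh n * real (steps n) = t" using steps_pos[of n] by (simp add: mesh_def)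

lemma mesh_lim: "mesh \<longlonglongrightarrow> 0"
  unfolding mesh_def[abs_def] steps_def by real_asymp

lemma node_measurable[measurable]: "B (real k * mesh n) \<in> borel_measurable M"
  using measurable_BM less_imp_le[OF mesh_pos[of n]] by simp

lemma \<xi>_measurable[measurable]: "\<xi> n k \<in> borel_measurable M"
  unfolding \<xi>_def[abs_def] by measurable

lemma pos_measurable[measurable]: "pos n k \<in> borel_measurable M"
  unfolding pos_def[abs_def] by measurable

lemma area_measurable[measurable]: "area n k \<in> borel_measurable M"
  unfolding area_def[abs_def] by measurable

lemma drift_measurable[measurable]: "drift n \<in> borel_measurable borel"
proof -
  have "drift n \<in> borel_measurable (borel \<Otimes>\<^sub>M borel)"
    unfolding drift_def[abs_def] by measurable
  then show ?thesis by (simp add: borel_prod)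
qed

lemma dr_measurable[measurable]: "dr n k \<in> borel_measurable M"
  unfolding dr_def[abs_def] by measurable

lemma pos'_measurable[measurable]: "pos' n k \<in> borel_measurable M"
  unfolding pos'_def[abs_def] by measurable

lemma area'_measurable[measurable]: "area' n k \<in> borel_measurable M"
  unfolding area'_def[abs_def] by measurable

lemma wt_measurable[measurable]: "wt n k \<in> borel_measurable M"
  unfolding wt_def[abs_def] by measurable

lemma grid_step_measurable: "case_prod (grid_step n) \<in> borel \<Otimes>\<^sub>M borel \<rightarrow>\<^sub>M borel"
proof -
  have "case_prod (grid_step n) \<in> (borel \<Otimes>\<^sub>M borel) \<Otimes>\<^sub>M borel \<rightarrow>\<^sub>M (borel \<Otimes>\<^sub>M borel)"
    unfolding grid_step_def by measurable
  then show ?thesis by (simp add: borel_prod)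
qed

lemma drift_bound: "\<bar>drift n p\<bar> \<le> 2 * \<bar>c\<bar> * (real n + 1)\<^sup>2"
proof (cases "exp (fst p) \<le> real (n + 1) \<and> 1 / real (n + 1) \<le> 1 - c * snd p")
  case True
  then have D: "1 / (real n + 1) \<le> 1 - c * snd p" and E: "exp (fst p) \<le> real n + 1"
    by (simp_all add: add.commute)
  have "0 < 1 / (real n + 1)" by simp
  then have Dpos: "0 < 1 - c * snd p" using D by linarith
  have "\<bar>drift n p\<bar> = 2 * \<bar>c\<bar> * exp (fst p) / (1 - c * snd p)"
    using True Dpos by (simp add: drift_def abs_mult)
  also have "\<dots> \<le> 2 * \<bar>c\<bar> * (real n + 1) / (1 / (real n + 1))"
    using D E by (intro frac_le mult_left_mono) auto
  finally show ?thesis by (simp add: power2_eq_square mult.assoc)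
qed (auto simp: drift_def)

lemma \<xi>_indep: "indep_vars (\<lambda>_. borel) (\<xi> n) {..<steps n}"
  unfolding \<xi>_def[abs_def]
  by (rule indep_increments[where \<tau> = "\<lambda>i. real i * mesh n"]) (use mesh_pos in \<open>auto\<close>)

lemma \<xi>_normal: "distributed M lborel (\<xi> n k) (normal_density 0 (sqrt (mesh n)))"
  using normal_increments[of "real k * mesh n" "real (Suc k) * mesh n"] mesh_pos[of n]
  by (simp add: \<xi>_def[abs_def] algebra_simps)

lemma girsanov_grid:
  assumes H: "H \<in> borel_measurable borel"
  shows "(\<integral>\<^sup>+\<omega>. H (pos' n (steps n) \<omega>, area' n (steps n) \<omega>) * ennreal (exp (wt n (steps n) \<omega>)) \<partial>M)
    = (\<integral>\<^sup>+\<omega>. H (pos n (steps n) \<omega>, area n (steps n) \<omega>) \<partial>M)"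
  by (rule discrete_girsanov[OF mesh_pos \<xi>_indep \<xi>_normal grid_step_measurable drift_measurable,
      where p = "\<lambda>k \<omega>. (pos n k \<omega>, area n k \<omega>)" and q = "\<lambda>k \<omega>. (pos' n k \<omega>, area' n k \<omega>)"
        and ?p0.0 = "(0, 0)"])
    (auto simp: pos_def area_def pos'_def area'_def wt_def grid_step_def dr_def algebra_simps intro: H)

lemma mart_lim: "AE \<omega> in M. (\<lambda>n. mart n (steps n) \<omega>) \<longlonglongrightarrow> 0"
proof (rule AE_tendsto_0_of_summable_squares)
  define b where "b n = real (steps n) * ((2 * \<bar>c\<bar> * (real n + 1)\<^sup>2)\<^sup>2 * (exp (mesh n) - 1 - mesh n))" for n
  have *: "mart n (steps n) \<in> borel_measurable M \<and>
      (\<integral>\<^sup>+\<omega>. ennreal ((mart n (steps n) \<omega>)\<^sup>2) \<partial>M) \<le> ennreal (b n)" for n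
    unfolding b_def
    by (rule martingale_square_bound[OF mesh_pos \<xi>_indep \<xi>_normal grid_step_measurable drift_measurable drift_bound,
      where p = "\<lambda>k \<omega>. (pos n k \<omega>, area n k \<omega>)" and ?p0.0 = "(0, 0)"])
    (auto simp: pos_def area_def mart_def grid_step_def dr_def algebra_simps)
  show "mart n (steps n) \<in> borel_measurable M" for n using * by blast
  have bn: "b n \<le> 4 * c\<^sup>2 * t\<^sup>2 * exp t * (1 / (real n + 1)\<^sup>2)" and b0: "0 \<le> b n" for n
  proof -
    have m: "mesh n \<le> t"
    proof -
      have "1 \<le> real (steps n)" using steps_pos[of n] by simp
      then show ?thesis using mesh_steps[of n] mesh_pos[of n] by (metis mult_left_mono mult.right_neutral less_imp_le)
    qed
    have "0 \<le> exp (mesh n) - 1 - mesh n" using exp_ge_add_one_self[of "mesh n"] by linarith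
    then show "0 \<le> b n" unfolding b_def by (intro mult_nonneg_nonneg) auto
    \<comment> \<open>The Taylor remainder makes each step quadratic in \<open>mesh n\<close>: one
      factor is used up by the number of steps, the other is left to beat the growth of the drift
      bound.\<close>
    have "exp (mesh n) - 1 - mesh n \<le> (mesh n)\<^sup>2 * exp t"
    proof -
      have "\<exists>s. \<bar>s\<bar> \<le> \<bar>mesh n\<bar> \<and> exp (mesh n) = (\<Sum>m<2. mesh n ^ m / fact m) + exp s / fact 2 * mesh n ^ 2"
        by (rule Maclaurin_exp_le)
      then obtain s where s: "\<bar>s\<bar> \<le> mesh n" "exp (mesh n) = 1 + mesh n + exp s / 2 * (mesh n)\<^sup>2"
        using mesh_pos[of n] by (auto simp: numeral_2_eq_2)
      have "exp s \<le> exp t" using s(1) m by simp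
      then have "exp s / 2 \<le> exp t" using exp_ge_zero[of s] by linarith
      then have "exp s / 2 * (mesh n)\<^sup>2 \<le> exp t * (mesh n)\<^sup>2"
        by (intro mult_right_mono) auto
      then show ?thesis using s(2) by (simp add: mult.commute)
    qed
    then have "b n \<le> real (steps n) * ((2 * \<bar>c\<bar> * (real n + 1)\<^sup>2)\<^sup>2 * ((mesh n)\<^sup>2 * exp t))"
      unfolding b_def by (intro mult_left_mono) auto
    also have "\<dots> = 4 * c\<^sup>2 * t\<^sup>2 * exp t * (1 / (real n + 1)\<^sup>2)"
    proof -
      have "real (steps n) = (real n + 1) ^ 6" by (simp add: steps_def add.commute)
      then show ?thesis
        by (simp add: mesh_def power_mult_distrib power_divide field_simps flip: power_mult power_add)
    qed
    finally show "b n \<le> 4 * c\<^sup>2 * t\<^sup>2 * exp t * (1 / (real n + 1)\<^sup>2)" .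
  qed
  show "(\<integral>\<^sup>+\<omega>. ennreal ((mart n (steps n) \<omega>)\<^sup>2) \<partial>M) \<le> ennreal (b n)" for n using * by blast
  show "0 \<le> b n" for n by (rule b0)
  have "summable (\<lambda>n. 4 * c\<^sup>2 * t\<^sup>2 * exp t * (1 / (real n + 1)\<^sup>2))"
  proof (intro summable_mult)
    have "summable (\<lambda>n. inverse ((real (Suc n))\<^sup>2))"
      using inverse_power_summable[of 2, where 'a = real] by (subst summable_Suc_iff) simp
    then show "summable (\<lambda>n. 1 / (real n + 1)\<^sup>2)" by (simp add: inverse_eq_divide add.commute)
  qed
  then show "summable b"
    by (rule summable_comparison_test') (use bn b0 in auto)
qed

lemma pos_eq: "pos n k \<omega> = B (real k * mesh n) \<omega> - B 0 \<omega> + (\<nu> - 1 / 2) * (real k * mesh n)"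
  unfolding pos_def sum.distrib \<xi>_def sum_lessThan_telescope[of "\<lambda>k. B (real k * mesh n) \<omega>"] by simp

text \<open>The factor \<open>exp (B 0 \<omega>)\<close> keeps the identity valid for every
  \<open>\<omega>\<close> and not just almost surely, so that \<open>exp_functional\<close> becomes
  a limit of measurable functions on all of \<open>space M\<close> even when \<open>M\<close> is not
  complete.\<close>

lemma exp_pos_eq: "exp (B 0 \<omega>) * exp (pos n k \<omega>) = geom_BM B \<nu> (real k * mesh n) \<omega>"
  by (simp add: pos_eq geom_BM_def exp_add[symmetric] algebra_simps)

lemma path_grid_axioms:
  assumes "\<omega> \<in> space M" "c' * exp_functional B \<nu> t \<omega> < 1"
  shows "path_grid (\<lambda>s. geom_BM B \<nu> s \<omega>) c' t mesh steps"
  using assms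
  by unfold_locales
    (auto simp: geom_BM_continuous t mesh_pos mesh_lim mesh_steps exp_functional_eq_integral,
     simp add: geom_BM_def)

lemma area_lim:
  assumes "\<omega> \<in> space M"
  shows "(\<lambda>n. exp (B 0 \<omega>) * area n (steps n) \<omega>) \<longlonglongrightarrow> exp_functional B \<nu> t \<omega>"
proof -
  \<comment> \<open>With the parameter 0 in place of \<open>c\<close> the domain condition is
    trivial, so no path is excluded.\<close>
  interpret path_grid "\<lambda>s. geom_BM B \<nu> s \<omega>" 0 t mesh steps
    by (rule path_grid_axioms[OF assms]) simp
  have "exp (B 0 \<omega>) * area n (steps n) \<omega> = Ag n (steps n)" for n
    by (simp add: area_def Ag_def xg_def exp_pos_eq[symmetric] sum_distrib_left mult_ac)
  then show ?thesis
    using Ag_lim[OF order.refl end_node] by (simp add: A_def exp_functional_eq_integral[OF assms])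
qed

lemma exp_functional_measurable: "exp_functional B \<nu> t \<in> borel_measurable M"
proof (rule borel_measurable_LIMSEQ_real)
  show "(\<lambda>n. exp (B 0 \<omega>) * area n (steps n) \<omega>) \<longlonglongrightarrow> exp_functional B \<nu> t \<omega>" if "\<omega> \<in> space M" for \<omega>
    by (rule area_lim[OF that])
  have [measurable]: "B 0 \<in> borel_measurable M" by (rule measurable_BM) simp
  show "(\<lambda>\<omega>. exp (B 0 \<omega>) * area n (steps n) \<omega>) \<in> borel_measurable M" for n by measurable
qed

text \<open>Once the truncation is inactive, \<open>dr\<close> agrees with
  \<open>P.\<theta>g\<close>, and all limits are those of a deterministic path; the only
  probabilistic inputs are the assumptions on \<open>mart\<close> and on \<open>B 0\<close>.\<close>

lemma shifted_limits:
  fixes \<omega> defines "D \<equiv> 1 - c * exp_functional B \<nu> t \<omega>"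
  assumes \<omega>: "\<omega> \<in> space M" and start: "B 0 \<omega> = 0" and mart: "(\<lambda>n. mart n (steps n) \<omega>) \<longlonglongrightarrow> 0"
    and dom: "c * exp_functional B \<nu> t \<omega> < 1"
  shows "(\<lambda>n. pos' n (steps n) \<omega>) \<longlonglongrightarrow> B t \<omega> + (\<nu> - 1 / 2) * t - 2 * ln D" (is ?pos)
    and "(\<lambda>n. area' n (steps n) \<omega>) \<longlonglongrightarrow> exp_functional B \<nu> t \<omega> / D" (is ?area)
    and "(\<lambda>n. wt n (steps n) \<omega>) \<longlonglongrightarrow> 2 * c - 2 * c * geom_BM B \<nu> t \<omega> / D - 2 * \<nu> * ln D" (is ?wt)
proof -
  interpret P: path_grid "\<lambda>s. geom_BM B \<nu> s \<omega>" c t mesh steps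
    by (rule path_grid_axioms[OF \<omega> dom])
  have A: "P.A t = exp_functional B \<nu> t \<omega>"
    by (simp add: P.A_def exp_functional_eq_integral[OF \<omega>])
  have D: "P.D t = D" by (simp add: P.D_def A D_def)
  have xg: "exp (pos n k \<omega>) = P.xg n k" for n k
    using exp_pos_eq[of \<omega> n k] by (simp add: start P.xg_def)
  have Ag: "area n k \<omega> = P.Ag n k" for n k
    by (simp add: area_def P.Ag_def xg)
  have "\<forall>\<^sub>F n in sequentially. \<forall>k\<le>steps n. P.xg n k \<le> real (n + 1) \<and> 1 / real (n + 1) \<le> P.Dg n k"
    by (rule P.eventually_untruncated) real_asymp
  then have dr: "\<forall>\<^sub>F n in sequentially. \<forall>k<steps n. dr n k \<omega> = P.\<theta>g n k"
    by eventually_elim (simp add: dr_def drift_def xg Ag P.\<theta>g_def P.Dg_def)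
  have dr_sum: "\<forall>\<^sub>F n in sequentially. \<forall>k\<le>steps n. (\<Sum>j<k. dr n j \<omega>) = (\<Sum>j<k. P.\<theta>g n j)"
    using dr by eventually_elim (auto intro!: sum.cong)
  show ?pos
  proof (rule Lim_transform_eventually)
    show "(\<lambda>n. B t \<omega> + (\<nu> - 1 / 2) * t + mesh n * (\<Sum>j<steps n. P.\<theta>g n j)) \<longlonglongrightarrow> B t \<omega> + (\<nu> - 1 / 2) * t - 2 * ln D"
      using tendsto_add[OF tendsto_const P.shift_lim[OF order.refl P.end_node], of "B t \<omega> + (\<nu> - 1 / 2) * t"]
      by (simp add: D)
    show "\<forall>\<^sub>F n in sequentially. B t \<omega> + (\<nu> - 1 / 2) * t + mesh n * (\<Sum>j<steps n. P.\<theta>g n j) = pos' n (steps n) \<omega>"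
      using dr_sum
    proof eventually_elim
      case (elim n)
      have "real (steps n) * mesh n = t" using mesh_steps[of n] by (simp add: mult.commute)
      then show ?case using elim by (simp add: pos'_def pos_eq start)
    qed
  qed
  show ?area
  proof (rule Lim_transform_eventually)
    show "(\<lambda>n. mesh n * (\<Sum>j<steps n. P.xg n j * exp (mesh n * (\<Sum>i<j. P.\<theta>g n i))))
        \<longlonglongrightarrow> exp_functional B \<nu> t \<omega> / D"
      using P.shifted_functional_lim by (simp add: A D)
    show "\<forall>\<^sub>F n in sequentially.
        mesh n * (\<Sum>j<steps n. P.xg n j * exp (mesh n * (\<Sum>i<j. P.\<theta>g n i))) = area' n (steps n) \<omega>"
      using dr_sum by eventually_elim (simp add: area'_def pos'_def exp_add xg)
  qed
  show ?wt
  proof (rule Lim_transform_eventually)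
    \<comment> \<open>With \<open>h\<close> for the mesh, \<open>- \<theta> * \<xi>\<close> is split
      into \<open>\<theta> * (exp (\<xi> - h / 2) - 1 - \<xi>)\<close> minus
      \<open>\<theta> * (exp (\<xi> - h / 2) - 1)\<close>. The first part sums to
      \<open>mart\<close>, the second belongs to \<open>P.weight_lim\<close>. The constant
      \<open>2 * c\<close> in the limit is the boundary term at time 0, where the path equals
      1.\<close>
    let ?L = "\<lambda>n. (\<Sum>j<steps n. P.\<theta>g n j * (exp (- \<nu> * mesh n) * P.xg n (Suc j) / P.xg n j - 1))
        + mesh n / 2 * (\<Sum>j<steps n. (P.\<theta>g n j)\<^sup>2)"
    have "(\<lambda>n. mart n (steps n) \<omega> - ?L n)
        \<longlonglongrightarrow> 0 - (2 * c * geom_BM B \<nu> t \<omega> / D - 2 * c * geom_BM B \<nu> 0 \<omega> + 2 * \<nu> * ln D)"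
      using P.weight_lim[of \<nu>] unfolding D by (intro tendsto_diff mart)
    then show "(\<lambda>n. mart n (steps n) \<omega> - ?L n) \<longlonglongrightarrow> 2 * c - 2 * c * geom_BM B \<nu> t \<omega> / D - 2 * \<nu> * ln D"
      by (simp add: geom_BM_def[of _ _ 0] start)
    show "\<forall>\<^sub>F n in sequentially. mart n (steps n) \<omega> - ?L n = wt n (steps n) \<omega>"
      using dr
    proof eventually_elim
      case (elim n)
      have ratio: "exp (- \<nu> * mesh n) * P.xg n (Suc j) / P.xg n j = exp (\<xi> n j \<omega> - mesh n / 2)" for j
      proof -
        have "pos n (Suc j) \<omega> = pos n j \<omega> + (\<xi> n j \<omega> + (\<nu> - 1 / 2) * mesh n)"
          by (simp add: pos_def)
        then show ?thesis
          unfolding xg[symmetric] by (simp add: exp_add[symmetric] exp_diff[symmetric] algebra_simps)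
      qed
      have "mart n (steps n) \<omega> - ?L n = (\<Sum>j<steps n. P.\<theta>g n j * (exp (\<xi> n j \<omega> - mesh n / 2) - 1 - \<xi> n j \<omega>)
          - P.\<theta>g n j * (exp (\<xi> n j \<omega> - mesh n / 2) - 1) - mesh n / 2 * (P.\<theta>g n j)\<^sup>2)"
        unfolding ratio mart_def using elim by (simp add: sum_subtractf sum_distrib_left)
      also have "\<dots> = wt n (steps n) \<omega>"
        unfolding wt_def using elim by (intro sum.cong refl) (simp add: algebra_simps)
      finally show ?case .
    qed
  qed
qed

text \<open>Fatou on the weighted side, where paths outside the domain are simply bounded below by
  0; dominated convergence on the other side, where \<open>G\<close> is bounded. Continuity of
  \<open>G\<close> is asked only at \<open>0 \<le> a\<close>, where the limits lie: the later test
  function \<open>density_ratio\<close> is singular at a negative argument.\<close>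

lemma girsanov_inequality:
  fixes G :: "real \<Rightarrow> real \<Rightarrow> real"
  assumes G_meas: "case_prod G \<in> borel_measurable borel"
    and G_nonneg: "\<And>b a. 0 \<le> G b a" and G_bounded: "\<And>b a. G b a \<le> K"
    and G_cont: "\<And>u v b a. u \<longlonglongrightarrow> b \<Longrightarrow> v \<longlonglongrightarrow> a \<Longrightarrow> 0 \<le> a \<Longrightarrow> (\<lambda>n. G (u n) (v n)) \<longlonglongrightarrow> G b a"
  defines "D \<equiv> \<lambda>\<omega>. 1 - c * exp_functional B \<nu> t \<omega>"
  shows "(\<integral>\<^sup>+\<omega>. (if 0 < D \<omega> then ennreal (G (B t \<omega> + (\<nu> - 1 / 2) * t - 2 * ln (D \<omega>)) (exp_functional B \<nu> t \<omega> / D \<omega>)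
        * exp (2 * c - 2 * c * geom_BM B \<nu> t \<omega> / D \<omega> - 2 * \<nu> * ln (D \<omega>))) else 0) \<partial>M)
    \<le> (\<integral>\<^sup>+\<omega>. ennreal (G (B t \<omega> + (\<nu> - 1 / 2) * t) (exp_functional B \<nu> t \<omega>)) \<partial>M)"
    (is "(\<integral>\<^sup>+\<omega>. ?f \<omega> \<partial>M) \<le> (\<integral>\<^sup>+\<omega>. ?g \<omega> \<partial>M)")
proof -
  note [measurable] = exp_functional_measurable
  have [measurable]: "B t \<in> borel_measurable M" using measurable_BM t by simp
  have [measurable]: "case_prod G \<in> borel_measurable (borel \<Otimes>\<^sub>M borel)"
    using G_meas by (simp add: borel_prod)
  define g where "g n \<omega> = ennreal (G (pos n (steps n) \<omega>) (area n (steps n) \<omega>))" for n \<omega>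
  define f where "f n \<omega> = ennreal (G (pos' n (steps n) \<omega>) (area' n (steps n) \<omega>) * exp (wt n (steps n) \<omega>))" for n \<omega>
  have [measurable]: "f n \<in> borel_measurable M" "g n \<in> borel_measurable M" for n
    unfolding f_def[abs_def] g_def[abs_def] by measurable
  have fg: "(\<integral>\<^sup>+\<omega>. f n \<omega> \<partial>M) = (\<integral>\<^sup>+\<omega>. g n \<omega> \<partial>M)" for n
    using girsanov_grid[of "\<lambda>p. ennreal (case_prod G p)" n] G_meas
    by (simp add: f_def g_def ennreal_mult G_nonneg)
  have g_lim: "AE \<omega> in M. (\<lambda>n. g n \<omega>) \<longlonglongrightarrow> ?g \<omega>"
    using start_zero AE_space
  proof eventually_elim
    case (elim \<omega>)
    have "pos n (steps n) \<omega> = B t \<omega> + (\<nu> - 1 / 2) * t" for n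
      using mesh_steps[of n] elim by (simp add: pos_eq mult.commute)
    moreover have "(\<lambda>n. area n (steps n) \<omega>) \<longlonglongrightarrow> exp_functional B \<nu> t \<omega>"
      using area_lim[OF elim(2)] elim(1) by simp
    ultimately show ?case
      unfolding g_def by (intro tendsto_ennrealI G_cont) (auto simp: exp_functional_nonneg)
  qed
  have "AE \<omega> in M. ?f \<omega> \<le> liminf (\<lambda>n. f n \<omega>)"
    using start_zero AE_space mart_lim
  proof eventually_elim
    case (elim \<omega>)
    show ?case
    proof (cases "0 < D \<omega>")
      case True
      then have dom: "c * exp_functional B \<nu> t \<omega> < 1" by (simp add: D_def)
      note lims = shifted_limits[OF elim(2,1,3) dom, folded D_def[THEN meta_eq_to_obj_eq, THEN fun_cong]]
      have "(\<lambda>n. f n \<omega>) \<longlonglongrightarrow> ?f \<omega>"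
        unfolding f_def using True
        by (simp, intro tendsto_ennrealI tendsto_mult tendsto_exp G_cont lims)
          (auto simp: exp_functional_nonneg)
      then have "liminf (\<lambda>n. f n \<omega>) = ?f \<omega>" by (intro lim_imp_Liminf) auto
      then show ?thesis by simp
    qed simp
  qed
  then have "(\<integral>\<^sup>+\<omega>. ?f \<omega> \<partial>M) \<le> (\<integral>\<^sup>+\<omega>. liminf (\<lambda>n. f n \<omega>) \<partial>M)"
    by (rule nn_integral_mono_AE)
  also have "\<dots> \<le> liminf (\<lambda>n. \<integral>\<^sup>+\<omega>. f n \<omega> \<partial>M)"
    by (rule nn_integral_liminf) measurable
  also have "\<dots> = liminf (\<lambda>n. \<integral>\<^sup>+\<omega>. g n \<omega> \<partial>M)"
    by (simp add: fg)
  also have "\<dots> = (\<integral>\<^sup>+\<omega>. ?g \<omega> \<partial>M)"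
  proof (rule lim_imp_Liminf)
    show "(\<lambda>n. \<integral>\<^sup>+\<omega>. g n \<omega> \<partial>M) \<longlonglongrightarrow> (\<integral>\<^sup>+\<omega>. ?g \<omega> \<partial>M)"
    proof (rule nn_integral_dominated_convergence[where w = "\<lambda>_. ennreal K"])
      show "(\<integral>\<^sup>+\<omega>. ennreal K \<partial>M) < \<infinity>" by (simp add: emeasure_space_1)
    qed (use g_lim in \<open>auto simp: g_def intro!: ennreal_leI G_bounded\<close>)
  qed simp
  finally show ?thesis .
qed

end

section \<open>The density ratio\<close>

lemma nn_integral_le_of_tendsto:
  assumes [measurable]: "\<And>n. f n \<in> borel_measurable M"
    and lim: "AE x in M. (\<lambda>n. f n x) \<longlonglongrightarrow> g x" and bound: "\<And>n. (\<integral>\<^sup>+x. f n x \<partial>M) \<le> (C :: ennreal)"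
  shows "(\<integral>\<^sup>+x. g x \<partial>M) \<le> C"
proof -
  have "(\<integral>\<^sup>+x. g x \<partial>M) = (\<integral>\<^sup>+x. liminf (\<lambda>n. f n x) \<partial>M)"
    by (rule nn_integral_cong_AE) (use lim in eventually_elim, simp add: lim_imp_Liminf)
  also have "\<dots> \<le> liminf (\<lambda>n. \<integral>\<^sup>+x. f n x \<partial>M)"
    by (rule nn_integral_liminf) measurable
  also have "\<dots> \<le> liminf (\<lambda>n :: nat. C)"
    by (rule Liminf_mono) (use bound in auto)
  finally show ?thesis by (simp add: Liminf_const)
qed

text \<open>The Girsanov density for \<open>c = - 1 / a\<close>, for which
  \<open>1 - c * y = (a + y) / a\<close>, at end point values \<open>x\<close> of \<open>X\<close>
  and \<open>y\<close> of \<open>A\<close>. A single exponential makes positivity evident;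
  \<open>density_ratio_eq\<close> recovers the integrand of the theorem with its prefactor.\<close>

definition density_ratio :: "real \<Rightarrow> real \<Rightarrow> real \<Rightarrow> real \<Rightarrow> real" where
  "density_ratio \<nu> a x y = exp (2 * \<nu> * ln (a / (a + y)) + 2 * x / (a + y) - 2 / a)"

lemma density_ratio_eq:
  assumes "0 < a" "0 \<le> y"
  shows "density_ratio \<nu> a x y = a powr (2 * \<nu>) * exp (- 2 / a) * ((a + y) powr (- 2 * \<nu>) * exp (2 * x / (a + y)))"
  using assms
  by (simp add: density_ratio_def powr_def ln_div exp_add[symmetric] exp_diff[symmetric] algebra_simps)

lemma density_ratio_tendsto:
  assumes "(u \<longlongrightarrow> x) F" "(v \<longlongrightarrow> y) F" "(w \<longlongrightarrow> a) F" "0 < a" "0 \<le> y"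
  shows "((\<lambda>n. density_ratio \<nu> (w n) (u n) (v n)) \<longlongrightarrow> density_ratio \<nu> a x y) F"
  unfolding density_ratio_def using assms by (intro tendsto_intros) auto

text \<open>Domination for letting \<open>b\<close> decrease to \<open>a\<close>. The sign of
  \<open>\<nu>\<close> is arbitrary, so the logarithm is controlled from both sides:
  \<open>b / (b + y)\<close> increases with \<open>b\<close>, and exceeds \<open>a / (a + y)\<close>
  at most by the factor \<open>b / a\<close>. The summand \<open>2 / a\<close> in the constant pays
  for estimating \<open>- 2 / b\<close> by 0.\<close>

lemma density_ratio_le:
  assumes a: "0 < a" and b: "a \<le> b" "b \<le> a + 1" and "0 \<le> x" "0 \<le> y"
  shows "density_ratio \<nu> b x y \<le> exp (2 * \<bar>\<nu>\<bar> * ln ((a + 1) / a) + 2 / a) * density_ratio \<nu> a x y"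
proof -
  have 1: "2 * x / (b + y) \<le> 2 * x / (a + y)"
    using assms by (intro divide_left_mono) auto
  define l where "l = ln (b / (b + y)) - ln (a / (a + y))"
  have l: "l = ln ((b / (b + y)) / (a / (a + y)))"
  proof -
    have "0 < b / (b + y)" "0 < a / (a + y)" using assms by auto
    then show ?thesis unfolding l_def by (rule ln_divide_pos[symmetric])
  qed
  have "0 \<le> l"
  proof -
    have "a / (a + y) \<le> b / (b + y)"
      using assms mult_right_mono[of a b y] by (simp add: field_simps)
    then show ?thesis using assms by (simp add: l_def)
  qed
  moreover have "l \<le> ln ((a + 1) / a)"
  proof -
    have "(b / (b + y)) / (a / (a + y)) = (b / a) * ((a + y) / (b + y))" by simp
    also have "\<dots> \<le> (a + 1) / a * 1"
      using assms by (intro mult_mono divide_right_mono) auto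
    finally show ?thesis unfolding l using assms by (subst ln_le_cancel_iff) auto
  qed
  ultimately have "\<bar>l\<bar> \<le> ln ((a + 1) / a)" by simp
  then have "\<bar>2 * \<nu> * l\<bar> \<le> 2 * \<bar>\<nu>\<bar> * ln ((a + 1) / a)"
    by (simp add: abs_mult mult_left_mono)
  then have 2: "2 * \<nu> * ln (b / (b + y)) \<le> 2 * \<nu> * ln (a / (a + y)) + 2 * \<bar>\<nu>\<bar> * ln ((a + 1) / a)"
    by (simp add: l_def right_diff_distrib abs_le_iff)
  have "- 2 / b \<le> 0" using assms by simp
  then have "2 * \<nu> * ln (b / (b + y)) + 2 * x / (b + y) - 2 / b
      \<le> (2 * \<bar>\<nu>\<bar> * ln ((a + 1) / a) + 2 / a) + (2 * \<nu> * ln (a / (a + y)) + 2 * x / (a + y) - 2 / a)"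
    using 1 2 by linarith
  then show ?thesis
    unfolding density_ratio_def exp_add[symmetric] by (simp only: exp_le_cancel_iff)
qed

section \<open>The two inequalities and the passage to the closed event\<close>

context brownian_motion begin

lemma geom_BM_measurable: "0 \<le> t \<Longrightarrow> geom_BM B \<nu> t \<in> borel_measurable M"
  unfolding geom_BM_def[abs_def] using measurable_BM[of t] by simp

lemma exp_functional_0: "\<omega> \<in> space M \<Longrightarrow> exp_functional B \<nu> 0 \<omega> = 0"
  by (simp add: exp_functional_eq_integral)

lemma exp_functional_borel:
  assumes "0 \<le> t"
  shows "exp_functional B \<nu> t \<in> borel_measurable M"
proof (cases "t = 0")
  case True
  then show ?thesis using exp_functional_0 by (simp cong: measurable_cong)
next
  case False
  then interpret BM_grid M B \<nu> 0 t by unfold_locales (use assms in auto)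
  show ?thesis by (rule exp_functional_measurable)
qed

text \<open>With \<open>c = - 1 / a\<close> the domain is everything and the image functional
  \<open>a * A / (a + A)\<close> always lies below \<open>a\<close>. Testing against the indicator
  of values below \<open>a\<close> thus leaves the bare weight on the left and the probability on
  the right.\<close>

lemma nn_integral_density_ratio_le:
  assumes t: "0 < t" and a: "0 < a"
  shows "(\<integral>\<^sup>+\<omega>. ennreal (density_ratio \<nu> a (geom_BM B \<nu> t \<omega>) (exp_functional B \<nu> t \<omega>)) \<partial>M)
    \<le> emeasure M {\<omega> \<in> space M. exp_functional B \<nu> t \<omega> < a}"
proof -
  interpret BM_grid M B \<nu> "- 1 / a" t by unfold_locales (rule t)
  let ?A = "exp_functional B \<nu> t" and ?X = "geom_BM B \<nu> t"
  have [measurable]: "?A \<in> borel_measurable M" "?X \<in> borel_measurable M" "B t \<in> borel_measurable M"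
    using t exp_functional_borel geom_BM_measurable measurable_BM by simp_all
  \<comment> \<open>Continuous functions increasing to the indicator of \<open>y < a\<close>. Such
    an approximation from below needs an open set, whence the strict inequality in the
    event.\<close>
  define G where "G m b y = min 1 (real m * max 0 (a - y))" for m and b y :: real
  define D where "D \<omega> = 1 - (- 1 / a) * ?A \<omega>" for \<omega>
  have D_pos: "0 < D \<omega>" for \<omega>
    using a exp_functional_nonneg[of B \<nu> t \<omega>] by (simp add: D_def add_pos_nonneg)
  define f where "f m \<omega> = ennreal (G m (B t \<omega> + (\<nu> - 1 / 2) * t - 2 * ln (D \<omega>)) (?A \<omega> / D \<omega>)
        * exp (2 * (- 1 / a) - 2 * (- 1 / a) * ?X \<omega> / D \<omega> - 2 * \<nu> * ln (D \<omega>)))" for m \<omega>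
  show ?thesis
  proof (rule nn_integral_le_of_tendsto[of f])
    fix m
    show "f m \<in> borel_measurable M" unfolding f_def[abs_def] G_def D_def by measurable
    have "(\<integral>\<^sup>+\<omega>. f m \<omega> \<partial>M) \<le> (\<integral>\<^sup>+\<omega>. ennreal (G m (B t \<omega> + (\<nu> - 1 / 2) * t) (?A \<omega>)) \<partial>M)"
    proof -
      have "case_prod (G m) \<in> borel_measurable (borel \<Otimes>\<^sub>M borel)"
        unfolding G_def by measurable
      then have "case_prod (G m) \<in> borel_measurable borel" by (simp add: borel_prod)
      moreover have "(\<lambda>n. G m (u n) (v n)) \<longlonglongrightarrow> G m b y" if "v \<longlonglongrightarrow> y" for u v b y
        unfolding G_def by (intro tendsto_intros that)
      ultimately show ?thesis
        using girsanov_inequality[of "G m" 1] D_pos by (simp add: f_def D_def G_def)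
    qed
    also have "\<dots> \<le> (\<integral>\<^sup>+\<omega>. indicator {\<omega> \<in> space M. ?A \<omega> < a} \<omega> \<partial>M)"
    proof (rule nn_integral_mono)
      fix \<omega> assume "\<omega> \<in> space M"
      then show "ennreal (G m (B t \<omega> + (\<nu> - 1 / 2) * t) (?A \<omega>)) \<le> indicator {\<omega> \<in> space M. ?A \<omega> < a} \<omega>"
        by (cases "?A \<omega> < a") (auto simp: G_def ennreal_le_1)
    qed
    also have "\<dots> = emeasure M {\<omega> \<in> space M. ?A \<omega> < a}"
      by (rule nn_integral_indicator) measurable
    finally show "(\<integral>\<^sup>+\<omega>. f m \<omega> \<partial>M) \<le> emeasure M {\<omega> \<in> space M. ?A \<omega> < a}" .
  next
    show "AE \<omega> in M. (\<lambda>m. f m \<omega>) \<longlonglongrightarrow> ennreal (density_ratio \<nu> a (?X \<omega>) (?A \<omega>))"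
    proof (rule AE_I2)
      fix \<omega>
      have A: "0 \<le> ?A \<omega>" by (rule exp_functional_nonneg)
      have aD: "D \<omega> = (a + ?A \<omega>) / a" using a by (simp add: D_def field_simps)
      have "?A \<omega> / D \<omega> < a" using a A by (simp add: aD field_simps)
      moreover have "(\<lambda>m. min 1 (real m * d)) \<longlonglongrightarrow> 1" if "0 < d" for d :: real
        using that by real_asymp
      ultimately have "(\<lambda>m. G m b (?A \<omega> / D \<omega>)) \<longlonglongrightarrow> 1" for b
        unfolding G_def by simp
      then have "(\<lambda>m. f m \<omega>) \<longlonglongrightarrow> ennreal (1 * exp (2 * (- 1 / a) - 2 * (- 1 / a) * ?X \<omega> / D \<omega> - 2 * \<nu> * ln (D \<omega>)))"
        unfolding f_def by (intro tendsto_ennrealI tendsto_mult tendsto_const)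
      moreover have "exp (2 * (- 1 / a) - 2 * (- 1 / a) * ?X \<omega> / D \<omega> - 2 * \<nu> * ln (D \<omega>)) = density_ratio \<nu> a (?X \<omega>) (?A \<omega>)"
        using a A by (simp add: density_ratio_def aD ln_div algebra_simps)
      ultimately show "(\<lambda>m. f m \<omega>) \<longlonglongrightarrow> ennreal (density_ratio \<nu> a (?X \<omega>) (?A \<omega>))" by simp
    qed
  qed
qed

text \<open>With \<open>c = 1 / a\<close> the domain is exactly \<open>A < a\<close>, and the weight
  is the reciprocal of \<open>density_ratio\<close> at the image point, since the transformation is
  the inverse of the one for \<open>- 1 / a\<close>. Testing against \<open>density_ratio\<close>
  therefore leaves the indicator of the domain on the left.\<close>

lemma emeasure_le_nn_integral_density_ratio:
  assumes t: "0 < t" and a: "0 < a"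
  shows "emeasure M {\<omega> \<in> space M. exp_functional B \<nu> t \<omega> < a}
    \<le> (\<integral>\<^sup>+\<omega>. ennreal (density_ratio \<nu> a (geom_BM B \<nu> t \<omega>) (exp_functional B \<nu> t \<omega>)) \<partial>M)"
proof -
  interpret BM_grid M B \<nu> "1 / a" t by unfold_locales (rule t)
  let ?A = "exp_functional B \<nu> t" and ?X = "geom_BM B \<nu> t"
  have [measurable]: "?A \<in> borel_measurable M" "?X \<in> borel_measurable M" "B t \<in> borel_measurable M"
    using t exp_functional_borel geom_BM_measurable measurable_BM by simp_all
  have X_eq: "?X \<omega> = exp (B t \<omega> + (\<nu> - 1 / 2) * t)" for \<omega>
    by (simp add: geom_BM_def algebra_simps)
  \<comment> \<open>The cap supplies the boundedness that \<open>girsanov_inequality\<close>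
    requires; a further use of Fatou's lemma lifts it.\<close>
  define G where "G m b y = min (real m) (density_ratio \<nu> a (exp b) y)" for m and b y :: real
  define D where "D \<omega> = 1 - (1 / a) * ?A \<omega>" for \<omega>
  define f where "f m \<omega> = (if 0 < D \<omega> then ennreal (G m (B t \<omega> + (\<nu> - 1 / 2) * t - 2 * ln (D \<omega>)) (?A \<omega> / D \<omega>)
        * exp (2 * (1 / a) - 2 * (1 / a) * ?X \<omega> / D \<omega> - 2 * \<nu> * ln (D \<omega>))) else 0)" for m \<omega>
  have "(\<integral>\<^sup>+\<omega>. indicator {\<omega> \<in> space M. ?A \<omega> < a} \<omega> \<partial>M)
    \<le> (\<integral>\<^sup>+\<omega>. ennreal (density_ratio \<nu> a (?X \<omega>) (?A \<omega>)) \<partial>M)"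
  proof (rule nn_integral_le_of_tendsto[of f])
    fix m
    show "f m \<in> borel_measurable M" unfolding f_def[abs_def] G_def D_def density_ratio_def by measurable
    have "(\<integral>\<^sup>+\<omega>. f m \<omega> \<partial>M) \<le> (\<integral>\<^sup>+\<omega>. ennreal (G m (B t \<omega> + (\<nu> - 1 / 2) * t) (?A \<omega>)) \<partial>M)"
      unfolding f_def D_def
    proof (rule girsanov_inequality)
      have "case_prod (G m) \<in> borel_measurable (borel \<Otimes>\<^sub>M borel)"
        unfolding G_def density_ratio_def by measurable
      then show "case_prod (G m) \<in> borel_measurable borel" by (simp add: borel_prod)
      show "0 \<le> G m b y" "G m b y \<le> real m" for b y by (auto simp: G_def density_ratio_def)
      show "(\<lambda>n. G m (u n) (v n)) \<longlonglongrightarrow> G m b y" if "u \<longlonglongrightarrow> b" "v \<longlonglongrightarrow> y" "0 \<le> y" for u v b y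
        unfolding G_def by (intro tendsto_min tendsto_const density_ratio_tendsto tendsto_exp that a)
    qed
    also have "\<dots> \<le> (\<integral>\<^sup>+\<omega>. ennreal (density_ratio \<nu> a (?X \<omega>) (?A \<omega>)) \<partial>M)"
      by (intro nn_integral_mono ennreal_leI) (simp add: G_def X_eq)
    finally show "(\<integral>\<^sup>+\<omega>. f m \<omega> \<partial>M) \<le> (\<integral>\<^sup>+\<omega>. ennreal (density_ratio \<nu> a (?X \<omega>) (?A \<omega>)) \<partial>M)" .
  next
    show "AE \<omega> in M. (\<lambda>m. f m \<omega>) \<longlonglongrightarrow> indicator {\<omega> \<in> space M. ?A \<omega> < a} \<omega>"
    proof (rule AE_I2)
      fix \<omega> assume \<omega>: "\<omega> \<in> space M"
      have dom: "0 < D \<omega> \<longleftrightarrow> ?A \<omega> < a" using a by (simp add: D_def field_simps)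
      show "(\<lambda>m. f m \<omega>) \<longlonglongrightarrow> indicator {\<omega> \<in> space M. ?A \<omega> < a} \<omega>"
      proof (cases "0 < D \<omega>")
        case True
        let ?b = "B t \<omega> + (\<nu> - 1 / 2) * t - 2 * ln (D \<omega>)"
        let ?w = "exp (2 * (1 / a) - 2 * (1 / a) * ?X \<omega> / D \<omega> - 2 * \<nu> * ln (D \<omega>))"
        have eb: "exp ?b = ?X \<omega> / (D \<omega>)\<^sup>2"
          using True by (simp add: X_eq exp_diff exp_double)
        have aD: "a + ?A \<omega> / D \<omega> = a / D \<omega>"
          using True a by (simp add: D_def field_simps)
        have "density_ratio \<nu> a (exp ?b) (?A \<omega> / D \<omega>) = exp (2 * \<nu> * ln (D \<omega>) + 2 * ?X \<omega> / (a * D \<omega>) - 2 / a)"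
          unfolding density_ratio_def eb aD using True a by (simp add: power2_eq_square)
        then have one: "density_ratio \<nu> a (exp ?b) (?A \<omega> / D \<omega>) * ?w = 1"
          by (simp add: exp_add[symmetric])
        have "(\<lambda>m. min (real m) r) \<longlonglongrightarrow> r" for r :: real by real_asymp
        then have "(\<lambda>m. ennreal (G m ?b (?A \<omega> / D \<omega>) * ?w)) \<longlonglongrightarrow> ennreal (density_ratio \<nu> a (exp ?b) (?A \<omega> / D \<omega>) * ?w)"
          unfolding G_def by (intro tendsto_ennrealI tendsto_mult tendsto_const)
        then show ?thesis using True \<omega> dom unfolding one f_def by simp
      qed (use dom in \<open>simp add: f_def\<close>)
    qed
  qed
  moreover have "(\<integral>\<^sup>+\<omega>. indicator {\<omega> \<in> space M. ?A \<omega> < a} \<omega> \<partial>M) = emeasure M {\<omega> \<in> space M. ?A \<omega> < a}"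
    by (rule nn_integral_indicator) measurable
  ultimately show ?thesis by simp
qed

text \<open>Equality for the strict events at levels \<open>b > a\<close> is carried to the limit on
  both sides: the events decrease to the closed one, and the expectations converge by domination.
  This avoids showing that the law of \<open>exp_functional\<close> has no atom at
  \<open>a\<close>.\<close>

lemma density_ratio_expectation:
  fixes \<nu> t a :: real
  assumes t: "0 < t" and a: "0 < a"
  defines "R \<equiv> \<lambda>a \<omega>. density_ratio \<nu> a (geom_BM B \<nu> t \<omega>) (exp_functional B \<nu> t \<omega>)"
  shows "integrable M (R a)"
    and "prob {\<omega> \<in> space M. exp_functional B \<nu> t \<omega> \<le> a} = expectation (R a)"
proof -
  let ?A = "exp_functional B \<nu> t" and ?X = "geom_BM B \<nu> t"
  have [measurable]: "?A \<in> borel_measurable M" "?X \<in> borel_measurable M"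
    using t exp_functional_borel geom_BM_measurable by simp_all
  have [measurable]: "R b \<in> borel_measurable M" for b
    unfolding R_def density_ratio_def by measurable
  have R_nonneg: "0 \<le> R b \<omega>" for b \<omega> by (simp add: R_def density_ratio_def)
  have nn: "(\<integral>\<^sup>+\<omega>. ennreal (R b \<omega>) \<partial>M) = ennreal (prob {\<omega> \<in> space M. ?A \<omega> < b})" if "0 < b" for b
    using nn_integral_density_ratio_le[OF t that, of \<nu>] emeasure_le_nn_integral_density_ratio[OF t that, of \<nu>]
    by (simp add: R_def emeasure_eq_measure)
  have int: "integrable M (R b)" if "0 < b" for b
    using nn[OF that] R_nonneg by (intro integrableI_nonneg) auto
  show "integrable M (R a)" by (rule int[OF a])
  have E: "expectation (R b) = prob {\<omega> \<in> space M. ?A \<omega> < b}" if "0 < b" for b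
    using nn[OF that] R_nonneg by (subst integral_eq_nn_integral) auto
  define b where "b n = a + 1 / real (Suc n)" for n
  have b: "0 < b n" "a \<le> b n" "b n \<le> a + 1" for n
    using a by (auto simp: b_def add_pos_pos)
  have b_lim: "b \<longlonglongrightarrow> a" unfolding b_def[abs_def] by real_asymp
  have "(\<lambda>n. expectation (R (b n))) \<longlonglongrightarrow> expectation (R a)"
  proof (rule integral_dominated_convergence)
    show "integrable M (\<lambda>\<omega>. exp (2 * \<bar>\<nu>\<bar> * ln ((a + 1) / a) + 2 / a) * R a \<omega>)"
      by (intro integrable_mult_right int a)
    show "AE \<omega> in M. (\<lambda>n. R (b n) \<omega>) \<longlonglongrightarrow> R a \<omega>"
      unfolding R_def
      by (intro AE_I2 density_ratio_tendsto tendsto_const b_lim a exp_functional_nonneg)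
    show "AE \<omega> in M. norm (R (b n) \<omega>) \<le> exp (2 * \<bar>\<nu>\<bar> * ln ((a + 1) / a) + 2 / a) * R a \<omega>" for n
      using density_ratio_le[OF a b(2,3)] R_nonneg
      by (simp add: R_def exp_functional_nonneg geom_BM_def)
  qed measurable
  moreover have "(\<lambda>n. prob {\<omega> \<in> space M. ?A \<omega> < b n}) \<longlonglongrightarrow> prob (\<Inter>n. {\<omega> \<in> space M. ?A \<omega> < b n})"
  proof (rule finite_Lim_measure_decseq)
    show "decseq (\<lambda>n. {\<omega> \<in> space M. ?A \<omega> < b n})"
    proof (intro decseq_SucI)
      fix n
      have "b (Suc n) \<le> b n" unfolding b_def by (intro add_left_mono divide_left_mono) auto
      then show "{\<omega> \<in> space M. ?A \<omega> < b (Suc n)} \<subseteq> {\<omega> \<in> space M. ?A \<omega> < b n}" by auto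
    qed
  qed auto
  moreover have "(\<Inter>n. {\<omega> \<in> space M. ?A \<omega> < b n}) = {\<omega> \<in> space M. ?A \<omega> \<le> a}"
  proof safe
    fix \<omega> assume *: "\<omega> \<in> (\<Inter>n. {\<omega> \<in> space M. ?A \<omega> < b n})"
    then show "\<omega> \<in> space M" by auto
    have "\<forall>n. ?A \<omega> \<le> b n" using * by (auto simp: less_imp_le)
    then show "?A \<omega> \<le> a" by (intro tendsto_lowerbound[OF b_lim]) auto
  next
    fix \<omega> n assume "?A \<omega> \<le> a"
    then show "?A \<omega> < b n" by (simp add: b_def order.strict_trans1)
  qed
  ultimately show "prob {\<omega> \<in> space M. ?A \<omega> \<le> a} = expectation (R a)"
    using LIMSEQ_unique by (auto simp: E[OF b(1)])
qed

end

theorem theorem5p2: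
  fixes M :: "'a measure" and B :: "real \<Rightarrow> 'a \<Rightarrow> real" and \<nu> t a :: real
  assumes "brownian_motion M B"
    and "0 \<le> t"
    and "0 < a"
  shows "integrable M (\<lambda>\<omega>. (a + exp_functional B \<nu> t \<omega>) powr (- 2 * \<nu>)
           * exp (2 * geom_BM B \<nu> t \<omega> / (a + exp_functional B \<nu> t \<omega>)))
       \<and> measure M {\<omega> \<in> space M. exp_functional B \<nu> t \<omega> \<le> a} =
         a powr (2 * \<nu>) * exp (- 2 / a) *
         (LINT \<omega>|M. (a + exp_functional B \<nu> t \<omega>) powr (- 2 * \<nu>)
           * exp (2 * geom_BM B \<nu> t \<omega> / (a + exp_functional B \<nu> t \<omega>)))"
proof -
  interpret brownian_motion M B by fact
  note t = assms(2) and a = assms(3)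
  let ?A = "exp_functional B \<nu> t" and ?X = "geom_BM B \<nu> t"
  let ?I = "\<lambda>\<omega>. (a + ?A \<omega>) powr (- 2 * \<nu>) * exp (2 * ?X \<omega> / (a + ?A \<omega>))"
  define R where "R \<omega> = density_ratio \<nu> a (?X \<omega>) (?A \<omega>)" for \<omega>
  have [measurable]: "?A \<in> borel_measurable M" "?X \<in> borel_measurable M"
    using t exp_functional_borel geom_BM_measurable by simp_all
  have R_meas[measurable]: "R \<in> borel_measurable M"
    unfolding R_def[abs_def] density_ratio_def by measurable
  define k where "k = a powr (2 * \<nu>) * exp (- 2 / a)"
  have k: "k \<noteq> 0" using a by (simp add: k_def)
  have R: "R = (\<lambda>\<omega>. k * ?I \<omega>)"
    unfolding R_def[abs_def] k_def by (intro ext density_ratio_eq a exp_functional_nonneg)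
  have "integrable M R \<and> prob {\<omega> \<in> space M. ?A \<omega> \<le> a} = expectation R"
  proof (cases "t = 0")
    case True
    \<comment> \<open>At \<open>t = 0\<close> the grid degenerates. Here \<open>A = 0\<close> and
      almost surely \<open>X = 1\<close>, so the exponent reduces to
      \<open>2 / a - 2 / a\<close>.\<close>
    have R1: "AE \<omega> in M. R \<omega> = 1"
      using start_zero AE_space
      by eventually_elim (use True a in \<open>simp add: R_def density_ratio_def exp_functional_0 geom_BM_def\<close>)
    have "integrable M R \<longleftrightarrow> integrable M (\<lambda>_. 1 :: real)"
      by (rule integrable_cong_AE) (use R1 in auto)
    moreover have "expectation R = expectation (\<lambda>_. 1)"
      by (rule integral_cong_AE) (use R1 in auto)
    moreover have "{\<omega> \<in> space M. ?A \<omega> \<le> a} = space M"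
      using True a by (auto simp: exp_functional_0)
    ultimately show ?thesis by (simp add: prob_space)
  next
    case False
    then show ?thesis
      using density_ratio_expectation[of t a \<nu>] t a by (simp add: R_def[abs_def])
  qed
  then show ?thesis
    using k unfolding R k_def[symmetric] by simp
qed

end
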